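(* Let $X$ be a projective variety of dimension $d$ over $\mathbb{C}$, let $S_\bullet$ be a graded linear series on $X$ corresponding to a big Cartier divisor $D$, and let $Y_\bullet$ be an admissible flag on $X$ such that $Y_1$ defines a Cartier divisor on $X$. Let $t=a/b>0$ be a rational number with $a,b$ coprime positive integers such that $\{t\}\times\mathbb{R}^{d-1}$ meets the interior of $\Delta_{Y_\bullet}(S_\bullet)$. Then, via the identification $\{t\}\times\mathbb{R}^{d-1}\cong\mathbb{R}^{d-1}$, $$\Delta_{Y_\bullet}(S_\bullet)_{\nu_1=t}=\frac1b\cdot\Delta_{X|Y_1}\bigl(S^{(b)}_\bullet-aY_1\bigr).$$
   Context: Divisors are integral Cartier divisors. A graded linear series $S_\bullet$ on $X$ corresponding to $D$ is a collection of finite-dimensional subspaces $S_k\subseteq H^0(X,\mathcal{O}_X(kD))$, $k\ge 0$, with $S_0=\mathbb{C}$ and $S_k\cdot S_l\subseteq S_{k+l}$ for all $k,l\ge0$. An admissible flag $Y_\bullet$ is a chain $X=Y_0\supseteq Y_1\supseteq\dots\supseteq Y_d=\{pt\}$ of irreducible subvarieties with $\operatorname{codim}_X(Y_i)=i$, each $Y_i$ nonsingular at the point $Y_d$. For a nonzero section $s\in S_k$ the valuation $\nu_{Y_\bullet}(s)=(\nu_1(s),\dots,\nu_d(s))\in\mathbb{Z}^d$ is defined iteratively: $\nu_1(s)$ is the order of vanishing of $s$ along $Y_1$; dividing $s$ (near $Y_d$) by the $\nu_1(s)$-th power of a local equation of $Y_1$ and restricting to $Y_1$ gives a nonzero section,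 whose order of vanishing along $Y_2$ is $\nu_2(s)$; and so on. Put $\Gamma(S_\bullet)=\{(\nu_{Y_\bullet}(s),k): s\in S_k\setminus\{0\},k\in\mathbb{N}\}$. The Newton-Okounkov body is $\Delta_{Y_\bullet}(S_\bullet)=\overline{\mathrm{Cone}(\Gamma(S_\bullet))}\cap(\mathbb{R}^d\times\{1\})$ (closed convex cone), viewed in $\mathbb{R}^d$. Its slice is $\Delta_{Y_\bullet}(S_\bullet)_{\nu_1=t}=\Delta_{Y_\bullet}(S_\bullet)\cap(\{t\}\times\mathbb{R}^{d-1})$. $S^{(b)}_\bullet$ is the Veronese series $S^{(b)}_k=S_{bk}$ (corresponding to $bD$). With $s_{Y_1}$ a defining section of $Y_1$, $S^{(b)}_\bullet-aY_1$ is the graded linear series corresponding to $bD-aY_1$ given by $(S^{(b)}_\bullet-aY_1)_k=\{s/s_{Y_1}^{ak}: s\in S_{bk},\ \operatorname{ord}_{Y_1}(s)\ge ak\}$. For a graded linear series $W_\bullet$ on $X$, the restricted series $W_{|Y_1,\bullet}$ on $Y_1$ consists of the images $W_{|Y_1,k}$ of $W_k$ under restriction of sections to $Y_1$, and $\Delta_{X|Y_1}(W_\bullet)=\Delta_{Y'_\bullet}(W_{|Y_1,\bullet})\subseteq\mathbb{R}^{d-1}$, where $Y'_\bullet$ is the flag $Y_1\supseteq Y_2\supseteq\dots\supseteq Y_d$ on $Y_1$. *)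

theory Defs
  imports "HOL-Analysis.Analysis" "HOL-Algebra.Embedded_Algebras" "HOL-Algebra.Ideal_Product"
begin

section \<open>Projective varieties\<close>

text \<open>
  A point of complex projective \<open>n\<close>-space is the set of its homogeneous coordinate vectors
  \<open>(x 0, \<dots>, x n)\<close>. Forms (homogeneous polynomials) are identified with the functions they define,
  which is harmless over an infinite field.
\<close>

type_synonym point = "(nat \<Rightarrow> complex) set"
type_synonym form = "(nat \<Rightarrow> complex) \<Rightarrow> complex"

definition proj_space :: "nat \<Rightarrow> point set" where
  "proj_space n =
    {{y. \<exists>c. c \<noteq> 0 \<and> y = (\<lambda>i. c * x i)} | x. (\<exists>i. x i \<noteq> 0) \<and> (\<forall>i>n. x i = 0)}"

definition is_form :: "nat \<Rightarrow> nat \<Rightarrow> form \<Rightarrow> bool" where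
  "is_form n e F \<longleftrightarrow> (\<exists>c :: (nat \<Rightarrow> nat) \<Rightarrow> complex.
     F = (\<lambda>x. \<Sum>m | (\<forall>i>n. m i = 0) \<and> (\<Sum>i\<le>n. m i) = e. c m * (\<Prod>i\<le>n. x i ^ m i)))"

definition vanishes_on :: "form \<Rightarrow> point set \<Rightarrow> bool" where
  "vanishes_on F A \<longleftrightarrow> (\<forall>P\<in>A. \<forall>x\<in>P. F x = 0)"

definition zariski_closed :: "nat \<Rightarrow> point set \<Rightarrow> bool" where
  "zariski_closed n A \<longleftrightarrow>
    (\<exists>T. (\<forall>F\<in>T. \<exists>e. is_form n e F) \<and> A = {P \<in> proj_space n. \<forall>F\<in>T. vanishes_on F {P}})"

definition zariski_open :: "nat \<Rightarrow> point set \<Rightarrow> bool" where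
  "zariski_open n U \<longleftrightarrow> U \<subseteq> proj_space n \<and> zariski_closed n (proj_space n - U)"

definition projective_variety :: "nat \<Rightarrow> point set \<Rightarrow> bool" where
  "projective_variety n X \<longleftrightarrow> zariski_closed n X \<and> X \<noteq> {} \<and>
    (\<forall>A B. zariski_closed n A \<and> zariski_closed n B \<and> X \<subseteq> A \<union> B \<longrightarrow> X \<subseteq> A \<or> X \<subseteq> B)"

text \<open>Supremum of the lengths \<open>k\<close> of strict chains \<open>c 0 \<subset> \<dots> \<subset> c k\<close> in a family of sets.\<close>

definition chain_height :: "'a set set \<Rightarrow> enat" where
  "chain_height \<C> =
    (SUP k\<in>{k. \<exists>c. (\<forall>i\<le>k. c i \<in> \<C>) \<and> (\<forall>i<k. c i \<subset> c (Suc i))}. enat k)"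

definition dimension_of :: "nat \<Rightarrow> point set \<Rightarrow> enat" where
  "dimension_of n X = chain_height {C. projective_variety n C \<and> C \<subseteq> X}"

definition codimension_of :: "nat \<Rightarrow> point set \<Rightarrow> point set \<Rightarrow> enat" where
  "codimension_of n X Z = chain_height {C. projective_variety n C \<and> Z \<subseteq> C \<and> C \<subseteq> X}"

section \<open>Rational functions and local rings\<close>

text \<open>
  The function field of \<open>X\<close> is the degree-zero part of the homogeneous localisation of the
  coordinate ring of \<open>X\<close>: classes of fractions \<open>F/G\<close> of forms of equal degree, with \<open>G\<close> not
  vanishing identically on \<open>X\<close>.
\<close>

type_synonym ratfun = "(form \<times> form) set"

definition fractions :: "nat \<Rightarrow> point set \<Rightarrow> (form \<times> form) set" where
  "fractions n X = {(F, G). (\<exists>e. is_form n e F \<and> is_form n e G) \<and> \<not> vanishes_on G X}"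

definition frac_rel :: "nat \<Rightarrow> point set \<Rightarrow> ((form \<times> form) \<times> (form \<times> form)) set" where
  "frac_rel n X = {((F, G), (F', G')). (F, G) \<in> fractions n X \<and> (F', G') \<in> fractions n X \<and>
     vanishes_on (\<lambda>x. F x * G' x - F' x * G x) X}"

definition frac :: "nat \<Rightarrow> point set \<Rightarrow> form \<Rightarrow> form \<Rightarrow> ratfun" where
  "frac n X F G = frac_rel n X `` {(F, G)}"

definition function_field :: "nat \<Rightarrow> point set \<Rightarrow> ratfun ring" where
  "function_field n X = \<lparr>
     carrier = fractions n X // frac_rel n X,
     mult = (\<lambda>\<phi> \<psi>. \<Union>(F, G)\<in>\<phi>. \<Union>(F', G')\<in>\<psi>. frac n X (\<lambda>x. F x * F' x) (\<lambda>x. G x * G' x)),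
     one = frac n X (\<lambda>_. 1) (\<lambda>_. 1),
     zero = frac n X (\<lambda>_. 0) (\<lambda>_. 1),
     add = (\<lambda>\<phi> \<psi>. \<Union>(F, G)\<in>\<phi>. \<Union>(F', G')\<in>\<psi>.
              frac n X (\<lambda>x. F x * G' x + F' x * G x) (\<lambda>x. G x * G' x))\<rparr>"

definition constants :: "nat \<Rightarrow> point set \<Rightarrow> ratfun set" where
  "constants n X = {frac n X (\<lambda>_. c) (\<lambda>_. 1) | c. True}"

text \<open>
  The local ring of \<open>X\<close> along a subvariety \<open>W\<close> (the stalk at its generic point); the local ring
  at a point \<open>p\<close> is the case \<open>W = {p}\<close>.
\<close>

definition local_ring :: "nat \<Rightarrow> point set \<Rightarrow> point set \<Rightarrow> ratfun ring" where
  "local_ring n X W = (function_field n X)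
     \<lparr>carrier := {\<phi> \<in> carrier (function_field n X). \<exists>(F, G)\<in>\<phi>. \<not> vanishes_on G W}\<rparr>"

text \<open>
  The ideal of a subvariety \<open>Z\<close> in \<open>local_ring n X W\<close>. For \<open>W = Z\<close> it is the maximal ideal, and it
  is the unit ideal if \<open>W\<close> is not contained in \<open>Z\<close>.
\<close>

definition local_ideal :: "nat \<Rightarrow> point set \<Rightarrow> point set \<Rightarrow> point set \<Rightarrow> ratfun set" where
  "local_ideal n X W Z =
    {\<phi> \<in> carrier (function_field n X). \<exists>(F, G)\<in>\<phi>. \<not> vanishes_on G W \<and> vanishes_on F Z}"

definition order_along :: "nat \<Rightarrow> point set \<Rightarrow> point set \<Rightarrow> ratfun \<Rightarrow> enat" where
  "order_along n X Z \<phi> =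
    (SUP k\<in>{k. \<phi> \<in> local_ideal n X Z Z [^]\<^bsub>ideals_set (local_ring n X Z)\<^esub> (k::nat)}. enat k)"

text \<open>Restriction to a subvariety \<open>Z\<close> of a rational function in the local ring of \<open>X\<close> along \<open>Z\<close>.\<close>

definition restrict_ratfun :: "nat \<Rightarrow> point set \<Rightarrow> ratfun \<Rightarrow> ratfun" where
  "restrict_ratfun n Z \<phi> = (\<Union>(F, G)\<in>{(F, G)\<in>\<phi>. \<not> vanishes_on G Z}. frac n Z F G)"

definition krull_dim :: "('a, 'b) ring_scheme \<Rightarrow> enat" where
  "krull_dim R = chain_height {I. primeideal I R}"

text \<open>Regularity of the local ring: its maximal ideal has a system of \<open>krull_dim\<close> many generators.\<close>

definition nonsingular_at :: "nat \<Rightarrow> point set \<Rightarrow> point \<Rightarrow> bool" where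
  "nonsingular_at n X p \<longleftrightarrow>
    (\<exists>G \<subseteq> carrier (local_ring n X {p}). finite G \<and>
       enat (card G) = krull_dim (local_ring n X {p}) \<and>
       Idl\<^bsub>local_ring n X {p}\<^esub> G = local_ideal n X {p} {p})"

section \<open>Cartier divisors and graded linear series\<close>

text \<open>
  A Cartier divisor on \<open>X\<close> is given by local equations: \<open>D p\<close> is a nonzero rational function
  that is a local equation in a neighbourhood of \<open>p\<close>. The divisor \<open>b D - a E\<close> has the local
  equations \<open>D p ^ b / E p ^ a\<close>. Sections of the associated line bundle are the rational functions
  \<open>s\<close> such that \<open>s * D p\<close> is regular at \<open>p\<close> for all \<open>p\<close>; the function \<open>s * D p\<close> is the section \<open>s\<close>
  read in the trivialisation at \<open>p\<close>.
\<close>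

type_synonym divisor = "point \<Rightarrow> ratfun"

definition cartier_divisor :: "nat \<Rightarrow> point set \<Rightarrow> divisor \<Rightarrow> bool" where
  "cartier_divisor n X D \<longleftrightarrow> (\<forall>p\<in>X.
     D p \<in> carrier (function_field n X) \<and> D p \<noteq> \<zero>\<^bsub>function_field n X\<^esub> \<and>
     (\<exists>U. zariski_open n U \<and> p \<in> U \<and>
        (\<forall>q\<in>U \<inter> X. D q \<otimes>\<^bsub>function_field n X\<^esub> inv\<^bsub>function_field n X\<^esub> (D p)
                      \<in> Units (local_ring n X {q}))))"

definition multiple :: "nat \<Rightarrow> point set \<Rightarrow> nat \<Rightarrow> divisor \<Rightarrow> divisor" where
  "multiple n X k D = (\<lambda>p. D p [^]\<^bsub>function_field n X\<^esub> k)"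

definition difference :: "nat \<Rightarrow> point set \<Rightarrow> divisor \<Rightarrow> divisor \<Rightarrow> divisor" where
  "difference n X D E =
    (\<lambda>p. D p \<otimes>\<^bsub>function_field n X\<^esub> inv\<^bsub>function_field n X\<^esub> (E p))"

definition global_sections :: "nat \<Rightarrow> point set \<Rightarrow> divisor \<Rightarrow> ratfun set" where
  "global_sections n X D = {s \<in> carrier (function_field n X).
     \<forall>p\<in>X. s \<otimes>\<^bsub>function_field n X\<^esub> D p \<in> carrier (local_ring n X {p})}"

definition h0 :: "nat \<Rightarrow> point set \<Rightarrow> divisor \<Rightarrow> nat" where
  "h0 n X D = ring.dim (function_field n X) (constants n X) (global_sections n X D)"

definition volume :: "nat \<Rightarrow> point set \<Rightarrow> divisor \<Rightarrow> ereal" where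
  "volume n X D = (let d = the_enat (dimension_of n X) in
     limsup (\<lambda>k. ereal (real (h0 n X (multiple n X k D)) / (real k ^ d / fact d))))"

definition big_divisor :: "nat \<Rightarrow> point set \<Rightarrow> divisor \<Rightarrow> bool" where
  "big_divisor n X D \<longleftrightarrow> cartier_divisor n X D \<and> volume n X D > 0"

text \<open>\<open>E\<close> is the Cartier divisor defined by the subvariety \<open>Z\<close>: its ideal sheaf is that of \<open>Z\<close>.\<close>

definition local_equation :: "nat \<Rightarrow> point set \<Rightarrow> point set \<Rightarrow> point \<Rightarrow> ratfun \<Rightarrow> bool" where
  "local_equation n X Z p g \<longleftrightarrow> g \<in> carrier (local_ring n X {p}) \<and>
     PIdl\<^bsub>local_ring n X {p}\<^esub> g = local_ideal n X {p} Z"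

definition divisor_of_subvariety :: "nat \<Rightarrow> point set \<Rightarrow> point set \<Rightarrow> divisor \<Rightarrow> bool" where
  "divisor_of_subvariety n X Z E \<longleftrightarrow>
     cartier_divisor n X E \<and> (\<forall>p\<in>X. local_equation n X Z p (E p))"

text \<open>
  Sections of multiples of an effective \<open>E\<close> being rational functions with poles bounded by \<open>E\<close>,
  the defining section of \<open>E\<close> is the constant \<open>1\<close>, which reads \<open>E p\<close> in the trivialisation at \<open>p\<close>.
\<close>

definition defining_section :: "nat \<Rightarrow> point set \<Rightarrow> ratfun" where
  "defining_section n X = \<one>\<^bsub>function_field n X\<^esub>"

text \<open>
  Order of vanishing along \<open>Z\<close> of a section of the line bundle of \<open>D\<close>; it does not depend on the
  point of \<open>Z\<close> at which the bundle is trivialised.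
\<close>

definition section_order :: "nat \<Rightarrow> point set \<Rightarrow> point set \<Rightarrow> divisor \<Rightarrow> ratfun \<Rightarrow> enat" where
  "section_order n X Z D s =
     order_along n X Z (s \<otimes>\<^bsub>function_field n X\<^esub> D (SOME p. p \<in> Z))"

type_synonym series = "nat \<Rightarrow> ratfun set"

definition graded_linear_series :: "nat \<Rightarrow> point set \<Rightarrow> divisor \<Rightarrow> series \<Rightarrow> bool" where
  "graded_linear_series n X D S \<longleftrightarrow>
     (\<forall>k. S k \<subseteq> global_sections n X (multiple n X k D) \<and>
          ring.finite_dimension (function_field n X) (constants n X) (S k)) \<and>
     S 0 = constants n X \<and>
     (\<forall>k l. \<forall>s\<in>S k. \<forall>t\<in>S l. s \<otimes>\<^bsub>function_field n X\<^esub> t \<in> S (k + l))"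

definition veronese :: "nat \<Rightarrow> series \<Rightarrow> series" where
  "veronese b S = (\<lambda>k. S (b * k))"

text \<open>
  The series \<open>T - a Z\<close> for a series \<open>T\<close> corresponding to \<open>D\<close>. It corresponds to the divisor
  \<open>difference n X D (multiple n X a E)\<close> if \<open>Z\<close> defines the Cartier divisor \<open>E\<close>.
\<close>

definition subtract_subvariety ::
  "nat \<Rightarrow> point set \<Rightarrow> point set \<Rightarrow> nat \<Rightarrow> divisor \<Rightarrow> series \<Rightarrow> series" where
  "subtract_subvariety n X Z a D T = (\<lambda>k.
     {s \<otimes>\<^bsub>function_field n X\<^esub>
        inv\<^bsub>function_field n X\<^esub> (defining_section n X [^]\<^bsub>function_field n X\<^esub> (a * k)) | s.
      s \<in> T k \<and> enat (a * k) \<le> section_order n X Z (multiple n X k D) s})"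

section \<open>Flags, valuations and Newton-Okounkov bodies\<close>

definition admissible_flag :: "nat \<Rightarrow> point set \<Rightarrow> nat \<Rightarrow> (nat \<Rightarrow> point set) \<Rightarrow> bool" where
  "admissible_flag n X d Y \<longleftrightarrow> Y 0 = X \<and>
     (\<forall>i\<le>d. projective_variety n (Y i) \<and> codimension_of n X (Y i) = enat i) \<and>
     (\<forall>i<d. Y (Suc i) \<subseteq> Y i) \<and>
     (\<exists>p. Y d = {p} \<and> (\<forall>i\<le>d. nonsingular_at n (Y i) p))"

definition flag_point :: "nat \<Rightarrow> (nat \<Rightarrow> point set) \<Rightarrow> point" where
  "flag_point d Y = the_elem (Y d)"

definition truncated_flag :: "(nat \<Rightarrow> point set) \<Rightarrow> (nat \<Rightarrow> point set)" where
  "truncated_flag Y = (\<lambda>i. Y (Suc i))"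

text \<open>
  \<open>flag_valuation n d Y f \<nu>\<close> says that \<open>(\<nu> 0, \<dots>, \<nu> (d - 1))\<close> is the valuation vector of the
  nonzero function \<open>f\<close> on \<open>Y 0\<close>, regular at the point of the flag. In each step \<open>f = g ^ \<nu> 0 * u\<close>
  for a local equation \<open>g\<close> of \<open>Y 1\<close> at that point, and one passes to the restriction of \<open>u\<close> to
  \<open>Y 1\<close>. The vector exists, is unique, and does not depend on the choice of \<open>g\<close>, since the members
  of the flag are nonsingular at the point. Its entries beyond \<open>d\<close> are set to \<open>0\<close>.
\<close>

primrec flag_valuation ::
  "nat \<Rightarrow> nat \<Rightarrow> (nat \<Rightarrow> point set) \<Rightarrow> ratfun \<Rightarrow> (nat \<Rightarrow> nat) \<Rightarrow> bool" where
  "flag_valuation n 0 Y f \<nu> \<longleftrightarrow>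
     f \<in> carrier (function_field n (Y 0)) \<and> f \<noteq> \<zero>\<^bsub>function_field n (Y 0)\<^esub> \<and> \<nu> = (\<lambda>_. 0)"
| "flag_valuation n (Suc d) Y f \<nu> \<longleftrightarrow>
     order_along n (Y 0) (Y 1) f = enat (\<nu> 0) \<and>
     (\<exists>g u. local_equation n (Y 0) (Y 1) (flag_point (Suc d) Y) g \<and>
        u \<in> carrier (local_ring n (Y 0) {flag_point (Suc d) Y}) \<and>
        f = g [^]\<^bsub>function_field n (Y 0)\<^esub> \<nu> 0 \<otimes>\<^bsub>function_field n (Y 0)\<^esub> u \<and>
        flag_valuation n d (truncated_flag Y) (restrict_ratfun n (Y 1) u) (\<lambda>i. \<nu> (Suc i)))"

text \<open>
  In the remaining definitions the variety is \<open>Y 0\<close>, of dimension \<open>d\<close>, and the series \<open>S\<close>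
  corresponds to the divisor \<open>D\<close>. Vectors of \<open>\<real>\<^sup>d\<close> are elements of \<open>Euclidean_space d\<close>.
\<close>

definition valuation_semigroup ::
  "nat \<Rightarrow> nat \<Rightarrow> (nat \<Rightarrow> point set) \<Rightarrow> divisor \<Rightarrow> series \<Rightarrow> ((nat \<Rightarrow> real) \<times> real) set" where
  "valuation_semigroup n d Y D S =
    {(\<lambda>i. real (\<nu> i), real k) | \<nu> k. \<exists>s \<in> S k - {\<zero>\<^bsub>function_field n (Y 0)\<^esub>}.
       flag_valuation n d Y
         (s \<otimes>\<^bsub>function_field n (Y 0)\<^esub> multiple n (Y 0) k D (flag_point d Y)) \<nu>}"

definition convex_cone_of :: "((nat \<Rightarrow> real) \<times> real) set \<Rightarrow> ((nat \<Rightarrow> real) \<times> real) set" where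
  "convex_cone_of \<Gamma> = {(\<lambda>i. \<Sum>v\<in>A. c v * fst v i, \<Sum>v\<in>A. c v * snd v) | A c.
     finite A \<and> A \<subseteq> \<Gamma> \<and> (\<forall>v\<in>A. c v \<ge> 0)}"

definition newton_okounkov_body ::
  "nat \<Rightarrow> nat \<Rightarrow> (nat \<Rightarrow> point set) \<Rightarrow> divisor \<Rightarrow> series \<Rightarrow> (nat \<Rightarrow> real) set" where
  "newton_okounkov_body n d Y D S =
    {x. (x, 1) \<in> prod_topology (Euclidean_space d) euclideanreal closure_of
                   convex_cone_of (valuation_semigroup n d Y D S)}"

text \<open>
  The restriction to \<open>Y 1\<close> of the line bundle of \<open>D\<close>, and of its sections. As \<open>Y 1\<close> may lie in the
  support of \<open>D\<close>, we first replace \<open>D\<close> by the linearly equivalent divisor with local equations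
  \<open>D q / D p\<close>, where \<open>p\<close> is the point of the flag, identifying a section \<open>s\<close> of \<open>D\<close> with the
  section \<open>s * D p\<close> of the new divisor. The local equations of the latter are units along \<open>Y 1\<close>.
\<close>

definition restricted_divisor :: "nat \<Rightarrow> nat \<Rightarrow> (nat \<Rightarrow> point set) \<Rightarrow> divisor \<Rightarrow> divisor" where
  "restricted_divisor n d Y D = (\<lambda>q. restrict_ratfun n (Y 1)
     (D q \<otimes>\<^bsub>function_field n (Y 0)\<^esub> inv\<^bsub>function_field n (Y 0)\<^esub> (D (flag_point d Y))))"

definition restricted_series ::
  "nat \<Rightarrow> nat \<Rightarrow> (nat \<Rightarrow> point set) \<Rightarrow> divisor \<Rightarrow> series \<Rightarrow> series" where
  "restricted_series n d Y D W = (\<lambda>k. (\<lambda>s. restrict_ratfun n (Y 1)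
     (s \<otimes>\<^bsub>function_field n (Y 0)\<^esub> multiple n (Y 0) k D (flag_point d Y))) ` W k)"

definition restricted_body ::
  "nat \<Rightarrow> nat \<Rightarrow> (nat \<Rightarrow> point set) \<Rightarrow> divisor \<Rightarrow> series \<Rightarrow> (nat \<Rightarrow> real) set" where
  "restricted_body n d Y D W =
     newton_okounkov_body n (d - 1) (truncated_flag Y)
       (restricted_divisor n d Y D) (restricted_series n d Y D W)"

end

theory Submission
  imports Defs
begin

text \<open>
  Let \<open>\<Gamma>\<close> be the semigroup of the pairs \<open>(\<nu>(s), k)\<close> of \<open>S\<close>, and \<open>L\<close> the hyperplane \<open>b \<nu>\<^sub>1 = a k\<close>. The left-hand
  side is the part of height one of \<open>L\<close> intersected with the closed cone over \<open>\<Gamma>\<close>. The proof compares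
  it with the closed cone over \<open>\<Gamma> \<inter> L\<close>, whose part of height one is the right-hand side.

  The algebraic half identifies \<open>\<Gamma> \<inter> L\<close> with the semigroup of the restricted series, by the map
  \<open>(y, k) \<mapsto> ((a k, y), b k)\<close>. Let \<open>p\<close> be the point of the flag and \<open>s\<close> in \<open>S (b k)\<close> a section of order at least
  \<open>a k\<close> along \<open>Y 1\<close>. It reads \<open>f = s * D p ^ (b k)\<close> at \<open>p\<close>, and its restriction as a section of
  \<open>k (b D - a E)\<close> is the restriction of \<open>f / E p ^ (a k)\<close> to \<open>Y 1\<close>. This quotient is regular at \<open>p\<close>, because
  \<open>E p\<close> is a prime element of the local ring (\<open>local_equation_divides\<close>). Its restriction is nonzero exactly
  if the order of \<open>s\<close> equals \<open>a k\<close>, and then, by the recursive definition of the valuation, it has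
  the valuation of \<open>s\<close> without its first entry (\<open>flag_valuation_Suc_divide\<close>,
  \<open>mem_restricted_semigroup_iff\<close>). Conversely, as \<open>a\<close> and \<open>b\<close> are coprime, all points of \<open>\<Gamma> \<inter> L\<close> have the
  form \<open>((a k, y), b k)\<close> with integral \<open>k\<close>.

  The convex half consists of two steps. First, the cone over \<open>\<Gamma>\<close> meets \<open>L\<close> in the cone over \<open>\<Gamma> \<inter> L\<close>:
  since \<open>L\<close> is rational and \<open>\<Gamma>\<close> is closed under addition (\<open>flag_valuation_mult\<close>), generators on opposite
  sides of \<open>L\<close> have a positive integral combination in \<open>\<Gamma> \<inter> L\<close> (\<open>convex_cone_of_hyperplane\<close>). Second,
  taking closures commutes with intersecting with \<open>L\<close>. Here it is used that \<open>L\<close> meets the interior: it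
  gives points of the cone on both sides of \<open>L\<close>, with which the cone is retracted continuously onto its
  section by \<open>L\<close> (\<open>closure_convex_cone_of_hyperplane\<close>).

  The groundwork is that the classes of fractions of forms make up a field, with local rings as
  subrings and restriction as a ring homomorphism to the function field of the subvariety. All of this
  rests on the primality of the forms that vanish on an irreducible variety. Where \<open>Y (i + 1)\<close>
  has a local equation in \<open>Y i\<close>, it generates the maximal ideal of the local ring along \<open>Y (i + 1)\<close>, so that orders of vanishing are exponents of local equations and
  add up under multiplication.
\<close>

section \<open>Homogeneous forms and irreducible loci\<close>

lemma finite_exponents: "finite {m :: nat \<Rightarrow> nat. (\<forall>i>n. m i = 0) \<and> (\<Sum>i\<le>n. m i) = e}"
proof (rule finite_subset)
  show "{m :: nat \<Rightarrow> nat. (\<forall>i>n. m i = 0) \<and> (\<Sum>i\<le>n. m i) = e}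
      \<subseteq> {m. \<forall>i. (i \<in> {..n} \<longrightarrow> m i \<in> {..e}) \<and> (i \<notin> {..n} \<longrightarrow> m i = 0)}"
    by (auto simp: not_le intro: member_le_sum)
  show "finite {m :: nat \<Rightarrow> nat. \<forall>i. (i \<in> {..n} \<longrightarrow> m i \<in> {..e}) \<and> (i \<notin> {..n} \<longrightarrow> m i = 0)}"
    by (rule finite_set_of_finite_funs) auto
qed

lemma is_form_zero: "is_form n e (\<lambda>_. 0)"
  unfolding is_form_def by (rule exI[of _ "\<lambda>_. 0"]) simp

lemma is_form_add:
  assumes "is_form n e F" and "is_form n e G"
  shows "is_form n e (\<lambda>x. F x + G x)"
proof -
  obtain c c' where
    F: "F = (\<lambda>x. \<Sum>m | (\<forall>i>n. m i = 0) \<and> (\<Sum>i\<le>n. m i) = e. c m * (\<Prod>i\<le>n. x i ^ m i))" and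
    G: "G = (\<lambda>x. \<Sum>m | (\<forall>i>n. m i = 0) \<and> (\<Sum>i\<le>n. m i) = e. c' m * (\<Prod>i\<le>n. x i ^ m i))"
    using assms unfolding is_form_def by blast
  show ?thesis unfolding is_form_def F G
    by (rule exI[of _ "\<lambda>m. c m + c' m"]) (simp add: sum.distrib distrib_right)
qed

lemma is_form_scale:
  assumes "is_form n e F"
  shows "is_form n e (\<lambda>x. a * F x)"
proof -
  obtain c where
    F: "F = (\<lambda>x. \<Sum>m | (\<forall>i>n. m i = 0) \<and> (\<Sum>i\<le>n. m i) = e. c m * (\<Prod>i\<le>n. x i ^ m i))"
    using assms unfolding is_form_def by blast
  show ?thesis unfolding is_form_def F
    by (rule exI[of _ "\<lambda>m. a * c m"]) (simp add: sum_distrib_left mult.assoc)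
qed

lemma is_form_sum:
  assumes "\<And>j. j \<in> J \<Longrightarrow> is_form n e (F j)"
  shows "is_form n e (\<lambda>x. \<Sum>j\<in>J. F j x)"
  using assms
  by (induction J rule: infinite_finite_induct) (auto intro: is_form_zero is_form_add)

lemma is_form_diff:
  assumes "is_form n e F" and "is_form n e G"
  shows "is_form n e (\<lambda>x. F x - G x)"
  using is_form_add[OF assms(1) is_form_scale[OF assms(2), of "- 1"]] by simp

lemma is_form_monomial:
  assumes "\<forall>i>n. m i = 0"
  shows "is_form n (\<Sum>i\<le>n. m i) (\<lambda>x. \<Prod>i\<le>n. x i ^ m i)"
proof -
  have "(\<Sum>m' | (\<forall>i>n. m' i = 0) \<and> (\<Sum>i\<le>n. m' i) = (\<Sum>i\<le>n. m i).
      (if m' = m then 1 else 0) * (\<Prod>i\<le>n. x i ^ m' i)) = (\<Prod>i\<le>n. x i ^ m i)"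
    for x :: "nat \<Rightarrow> complex"
    using sum.delta[OF finite_exponents, of m "\<lambda>m. \<Prod>i\<le>n. x i ^ m i" n "\<Sum>i\<le>n. m i"] assms
    by (simp add: if_distrib if_distribR cong: if_cong)
  then show ?thesis unfolding is_form_def
    by (intro exI[of _ "\<lambda>m'. if m' = m then 1 else 0"]) simp
qed

lemma is_form_mult:
  assumes "is_form n e F" and "is_form n e' G"
  shows "is_form n (e + e') (\<lambda>x. F x * G x)"
proof -
  obtain c c' where
    F: "F = (\<lambda>x. \<Sum>m | (\<forall>i>n. m i = 0) \<and> (\<Sum>i\<le>n. m i) = e. c m * (\<Prod>i\<le>n. x i ^ m i))" and
    G: "G = (\<lambda>x. \<Sum>m | (\<forall>i>n. m i = 0) \<and> (\<Sum>i\<le>n. m i) = e'. c' m * (\<Prod>i\<le>n. x i ^ m i))"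
    using assms unfolding is_form_def by blast
  have "(\<lambda>x. F x * G x) = (\<lambda>x. \<Sum>m | (\<forall>i>n. m i = 0) \<and> (\<Sum>i\<le>n. m i) = e.
      \<Sum>m' | (\<forall>i>n. m' i = 0) \<and> (\<Sum>i\<le>n. m' i) = e'.
        (c m * c' m') * (\<Prod>i\<le>n. x i ^ (m i + m' i)))"
    unfolding F G sum_product
    by (intro ext sum.cong refl) (simp add: power_add prod.distrib mult.assoc mult.left_commute)
  moreover have "is_form n (e + e') (\<lambda>x. \<Sum>m | (\<forall>i>n. m i = 0) \<and> (\<Sum>i\<le>n. m i) = e.
      \<Sum>m' | (\<forall>i>n. m' i = 0) \<and> (\<Sum>i\<le>n. m' i) = e'.
        (c m * c' m') * (\<Prod>i\<le>n. x i ^ (m i + m' i)))"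
  proof (intro is_form_sum is_form_scale, clarsimp)
    fix m m' :: "nat \<Rightarrow> nat"
    assume "\<forall>i>n. m i = 0" "\<forall>i>n. m' i = 0"
    then show "is_form n (sum m {..n} + sum m' {..n}) (\<lambda>x. \<Prod>i\<le>n. x i ^ (m i + m' i))"
      using is_form_monomial[of n "\<lambda>i. m i + m' i"] by (simp add: sum.distrib)
  qed
  ultimately show ?thesis by simp
qed

lemma is_form_const: "is_form n 0 (\<lambda>_. c)"
  using is_form_scale[OF is_form_monomial[of n "\<lambda>_. 0"], of c] by simp

lemma is_form_coordinate_power:
  assumes "i \<le> n"
  shows "is_form n e (\<lambda>x. x i ^ e)"
proof -
  have *: "(if j = i then e else 0) = (if i = j then e else 0)" for j by simp
  have "(\<Prod>j\<le>n. x j ^ (if j = i then e else 0)) = x i ^ e" for x :: "nat \<Rightarrow> complex"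
    using assms by (simp add: if_distrib[of "power _"] cong: if_cong)
  then show ?thesis
    using is_form_monomial[of n "\<lambda>j. if j = i then e else 0"] assms by simp
qed

lemma is_form_homogeneous:
  assumes "is_form n e F"
  shows "F (\<lambda>i. a * x i) = a ^ e * F x"
proof -
  obtain c where
    F: "F = (\<lambda>x. \<Sum>m | (\<forall>i>n. m i = 0) \<and> (\<Sum>i\<le>n. m i) = e. c m * (\<Prod>i\<le>n. x i ^ m i))"
    using assms unfolding is_form_def by blast
  show ?thesis
    unfolding F by (auto simp: power_mult_distrib prod.distrib sum_distrib_left power_sum intro!: sum.cong)
qed

text \<open>
  Irreducibility enters the construction of the function field and of its local rings only as
  primality of the forms vanishing on \<open>V\<close>. By homogeneity this also holds for single points, so
  that points and varieties can be treated alike.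
\<close>

locale irreducible_locus =
  fixes n :: nat and V :: "point set"
  assumes locus_subset: "V \<subseteq> proj_space n"
    and locus_nonempty: "V \<noteq> {}"
    and vanishes_on_factor: "\<And>F G e e'. is_form n e F \<Longrightarrow> is_form n e' G \<Longrightarrow>
      vanishes_on (\<lambda>x. F x * G x) V \<Longrightarrow> vanishes_on F V \<or> vanishes_on G V"

lemma vanishes_at_point:
  assumes "P \<in> proj_space n" and "is_form n e F" and "x \<in> P" and "F x = 0"
  shows "vanishes_on F {P}"
proof -
  obtain z where P: "P = {y. \<exists>c. c \<noteq> 0 \<and> y = (\<lambda>i. c * z i)}"
    using assms(1) unfolding proj_space_def by blast
  then obtain c where c: "c \<noteq> 0" "x = (\<lambda>i. c * z i)" using assms(3) by blast
  have "F z = 0"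
    using assms(4) is_form_homogeneous[OF assms(2), of c z] c by simp
  then show ?thesis
    unfolding vanishes_on_def P using is_form_homogeneous[OF assms(2)] by auto
qed

lemma vanishes_on_mult_point:
  assumes "P \<in> proj_space n" and "is_form n e F" and "is_form n e' G"
    and "vanishes_on (\<lambda>x. F x * G x) {P}"
  shows "vanishes_on F {P} \<or> vanishes_on G {P}"
proof (cases "vanishes_on F {P}")
  case False
  then obtain x where "x \<in> P" "F x \<noteq> 0" unfolding vanishes_on_def by blast
  moreover from this have "G x = 0" using assms(4) unfolding vanishes_on_def by auto
  ultimately show ?thesis using vanishes_at_point[OF assms(1,3)] by blast
qed simp

lemma irreducible_locus_point:
  assumes "P \<in> proj_space n"
  shows "irreducible_locus n {P}"
proof
  show "{P} \<subseteq> proj_space n" and "{P} \<noteq> {}" using assms by auto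
qed (rule vanishes_on_mult_point[OF assms])

lemma irreducible_locus_projective_variety:
  assumes "projective_variety n V"
  shows "irreducible_locus n V"
proof -
  have "V \<subseteq> proj_space n"
    using assms unfolding projective_variety_def zariski_closed_def by auto
  moreover have "vanishes_on F V \<or> vanishes_on G V"
    if F: "is_form n e F" and G: "is_form n e' G" and FG: "vanishes_on (\<lambda>x. F x * G x) V"
    for F G e e'
  proof -
    define Z where "Z = (\<lambda>H. {P \<in> proj_space n. \<forall>F\<in>{H}. vanishes_on F {P}})"
    have closed: "zariski_closed n (Z H)" if "is_form n e H" for H e
      unfolding zariski_closed_def Z_def using that by (intro exI[of _ "{H}"]) auto
    have "vanishes_on (\<lambda>x. F x * G x) {P}" if "P \<in> V" for P
      using FG that unfolding vanishes_on_def by blast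
    then have "V \<subseteq> Z F \<union> Z G"
      using vanishes_on_mult_point[OF _ F G] \<open>V \<subseteq> proj_space n\<close> unfolding Z_def by auto
    then have "V \<subseteq> Z F \<or> V \<subseteq> Z G"
      using assms closed[OF F] closed[OF G] unfolding projective_variety_def by blast
    then show ?thesis unfolding Z_def vanishes_on_def by auto
  qed
  moreover have "V \<noteq> {}" using assms unfolding projective_variety_def by simp
  ultimately show ?thesis by unfold_locales
qed

lemma vanishes_on_mono: "vanishes_on F A \<Longrightarrow> B \<subseteq> A \<Longrightarrow> vanishes_on F B"
  unfolding vanishes_on_def by blast

lemma UN_pair_eq:
  assumes "p \<in> A" and "\<And>F G. (F, G) \<in> A \<Longrightarrow> h F G = c"
  shows "(\<Union>(F, G)\<in>A. h F G) = c"
  using assms(2) by (intro UN_constant_eq[OF assms(1)]) auto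

lemma UN_pairs_eq:
  assumes "p \<in> A" and "q \<in> B"
    and "\<And>F G F' G'. (F, G) \<in> A \<Longrightarrow> (F', G') \<in> B \<Longrightarrow> h F G F' G' = c"
  shows "(\<Union>(F, G)\<in>A. \<Union>(F', G')\<in>B. h F G F' G') = c"
  using assms(3) by (intro UN_pair_eq[OF assms(1)] UN_pair_eq[OF assms(2)])

section \<open>The function field\<close>

context irreducible_locus
begin

abbreviation K :: "ratfun ring" where "K \<equiv> function_field n V"

lemma vanishes_mult_iff:
  assumes "is_form n e F" and "is_form n e' G"
  shows "vanishes_on (\<lambda>x. F x * G x) V \<longleftrightarrow> vanishes_on F V \<or> vanishes_on G V"
  using vanishes_on_factor[OF assms] by (auto simp: vanishes_on_def)

lemma not_vanishes_const: "c \<noteq> 0 \<Longrightarrow> \<not> vanishes_on (\<lambda>_. c) V"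
proof -
  assume c: "c \<noteq> 0"
  obtain P where P: "P \<in> V" using locus_nonempty by blast
  then obtain z where "P = {y. \<exists>c. c \<noteq> 0 \<and> y = (\<lambda>i. c * z i)}"
    using locus_subset unfolding proj_space_def by blast
  then have "z \<in> P" by (auto intro!: exI[of _ "1 :: complex"])
  then show ?thesis using P c unfolding vanishes_on_def by blast
qed

lemma fractions_iff:
  "(F, G) \<in> fractions n V \<longleftrightarrow> (\<exists>e. is_form n e F \<and> is_form n e G) \<and> \<not> vanishes_on G V"
  unfolding fractions_def by simp

lemma fractions_mult:
  assumes "(F, G) \<in> fractions n V" and "(F', G') \<in> fractions n V"
  shows "(\<lambda>x. F x * F' x, \<lambda>x. G x * G' x) \<in> fractions n V"
proof -
  obtain e e' where "is_form n e F" "is_form n e G" "is_form n e' F'" "is_form n e' G'"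
    using assms fractions_iff by auto
  then have "is_form n (e + e') (\<lambda>x. F x * F' x)" "is_form n (e + e') (\<lambda>x. G x * G' x)"
    and "\<not> vanishes_on (\<lambda>x. G x * G' x) V"
    using assms vanishes_on_factor[of e G e' G'] fractions_iff by (auto intro: is_form_mult)
  then show ?thesis unfolding fractions_iff by blast
qed

lemma fractions_add:
  assumes "(F, G) \<in> fractions n V" and "(F', G') \<in> fractions n V"
  shows "(\<lambda>x. F x * G' x + F' x * G x, \<lambda>x. G x * G' x) \<in> fractions n V"
proof -
  obtain e e' where f: "is_form n e F" "is_form n e G" "is_form n e' F'" "is_form n e' G'"
    using assms fractions_iff by auto
  have "is_form n (e + e') (\<lambda>x. F x * G' x + F' x * G x)"
    using is_form_add[OF is_form_mult[OF f(1,4)], of "\<lambda>x. F' x * G x"] is_form_mult[OF f(3,2)]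
    by (simp add: add.commute[of e'])
  moreover note is_form_mult[OF f(2,4)]
  moreover have "\<not> vanishes_on (\<lambda>x. G x * G' x) V"
    using assms vanishes_on_factor[OF f(2,4)] unfolding fractions_iff by auto
  ultimately show ?thesis unfolding fractions_iff by blast
qed

lemma fractions_const: "(\<lambda>_. c, \<lambda>_. 1) \<in> fractions n V"
  unfolding fractions_iff using is_form_const not_vanishes_const[of 1] by auto

lemma frac_rel_iff:
  "((F, G), (F', G')) \<in> frac_rel n V \<longleftrightarrow> (F, G) \<in> fractions n V \<and> (F', G') \<in> fractions n V \<and>
     (\<forall>P\<in>V. \<forall>x\<in>P. F x * G' x = F' x * G x)"
  unfolding frac_rel_def vanishes_on_def by simp

text \<open>
  Transitivity amounts to cancelling the denominator in the middle, which irreducibility permits.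
\<close>

lemma equiv_frac_rel: "equiv (fractions n V) (frac_rel n V)"
proof (rule equivI)
  show "frac_rel n V \<subseteq> fractions n V \<times> fractions n V"
    by (auto simp: frac_rel_iff)
  show "refl_on (fractions n V) (frac_rel n V)"
    unfolding refl_on_def by (auto simp: frac_rel_iff)
  show "sym (frac_rel n V)"
    unfolding sym_def by (auto simp: frac_rel_iff)
  show "trans (frac_rel n V)"
  proof (rule transI, clarify)
    fix F G F' G' F'' G''
    assume r: "((F, G), (F', G')) \<in> frac_rel n V" and r': "((F', G'), (F'', G'')) \<in> frac_rel n V"
    obtain e e' e'' where f: "is_form n e F" "is_form n e G" "is_form n e' F'" "is_form n e' G'"
        "is_form n e'' F''" "is_form n e'' G''"
      using r r' unfolding frac_rel_iff fractions_iff by blast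
    have form: "is_form n (e + e'') (\<lambda>x. F x * G'' x - F'' x * G x)"
      using is_form_diff[OF is_form_mult[OF f(1,6)]] is_form_mult[OF f(5,2)]
      by (simp add: add.commute)
    have "vanishes_on (\<lambda>x. G' x * (F x * G'' x - F'' x * G x)) V"
      unfolding vanishes_on_def
    proof (intro ballI)
      fix P x assume "P \<in> V" "x \<in> P"
      then have "F x * G' x = F' x * G x" "F' x * G'' x = F'' x * G' x"
        using r r' unfolding frac_rel_iff by auto
      moreover have "G' x * (F x * G'' x - F'' x * G x)
          = (F x * G' x) * G'' x - (F'' x * G' x) * G x" by (simp add: algebra_simps)
      ultimately show "G' x * (F x * G'' x - F'' x * G x) = 0" by simp
    qed
    then have "vanishes_on (\<lambda>x. F x * G'' x - F'' x * G x) V"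
      using vanishes_on_factor[OF f(4) form] r' unfolding frac_rel_iff fractions_iff by argo
    then show "((F, G), (F'', G'')) \<in> frac_rel n V"
      using r r' unfolding frac_rel_def by simp
  qed
qed

lemma frac_eq_iff:
  assumes "(F, G) \<in> fractions n V" and "(F', G') \<in> fractions n V"
  shows "frac n V F G = frac n V F' G' \<longleftrightarrow> (\<forall>P\<in>V. \<forall>x\<in>P. F x * G' x = F' x * G x)"
  unfolding frac_def using eq_equiv_class_iff[OF equiv_frac_rel assms] assms
  by (simp add: frac_rel_iff)

lemma mem_frac_iff:
  "(F', G') \<in> frac n V F G \<longleftrightarrow> (F, G) \<in> fractions n V \<and> (F', G') \<in> fractions n V
    \<and> frac n V F G = frac n V F' G'"
  unfolding frac_def using equiv_class_eq_iff[OF equiv_frac_rel, of "(F, G)" "(F', G')"] by auto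

lemma frac_closed: "(F, G) \<in> fractions n V \<Longrightarrow> frac n V F G \<in> carrier K"
  unfolding function_field_def frac_def by (simp add: quotientI)

lemma function_field_cases:
  assumes "\<phi> \<in> carrier K"
  obtains F G where "\<phi> = frac n V F G" and "(F, G) \<in> fractions n V"
proof -
  have "\<phi> \<in> fractions n V // frac_rel n V" using assms by (simp add: function_field_def)
  then obtain FG where "FG \<in> fractions n V" "\<phi> = frac_rel n V `` {FG}" by (rule quotientE)
  then show thesis using that[of "fst FG" "snd FG"] unfolding frac_def by simp
qed

lemma mem_carrier_iff:
  assumes "\<phi> \<in> carrier K"
  shows "(F, G) \<in> \<phi> \<longleftrightarrow> (F, G) \<in> fractions n V \<and> \<phi> = frac n V F G"
  using assms by (metis function_field_cases mem_frac_iff)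

lemma frac_self: "(F, G) \<in> fractions n V \<Longrightarrow> (F, G) \<in> frac n V F G"
  by (simp add: mem_frac_iff)

lemma frac_mult:
  assumes "(F, G) \<in> fractions n V" and "(F', G') \<in> fractions n V"
  shows "frac n V F G \<otimes>\<^bsub>K\<^esub> frac n V F' G' = frac n V (\<lambda>x. F x * F' x) (\<lambda>x. G x * G' x)"
proof -
  have *: "frac n V (\<lambda>x. A x * A' x) (\<lambda>x. B x * B' x) = frac n V (\<lambda>x. F x * F' x) (\<lambda>x. G x * G' x)"
    if h: "(A, B) \<in> frac n V F G" and h': "(A', B') \<in> frac n V F' G'" for A B A' B'
  proof -
    have fr: "(A, B) \<in> fractions n V" "(A', B') \<in> fractions n V"
      using h h' by (auto simp: mem_frac_iff)
    have "A x * A' x * (G x * G' x) = F x * F' x * (B x * B' x)" if "P \<in> V" "x \<in> P" for P x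
    proof -
      have "A x * G x = F x * B x" "A' x * G' x = F' x * B' x"
        using h h' that frac_eq_iff[OF fr(1) assms(1)] frac_eq_iff[OF fr(2) assms(2)]
        by (auto simp: mem_frac_iff)
      then show ?thesis by (metis mult.assoc mult.left_commute)
    qed
    then show ?thesis
      using frac_eq_iff[OF fractions_mult[OF fr] fractions_mult[OF assms]] by simp
  qed
  show ?thesis
    unfolding function_field_def monoid.simps
    by (rule UN_pairs_eq[OF frac_self[OF assms(1)] frac_self[OF assms(2)] *])
qed

lemma frac_add:
  assumes "(F, G) \<in> fractions n V" and "(F', G') \<in> fractions n V"
  shows "frac n V F G \<oplus>\<^bsub>K\<^esub> frac n V F' G'
    = frac n V (\<lambda>x. F x * G' x + F' x * G x) (\<lambda>x. G x * G' x)"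
proof -
  have *: "frac n V (\<lambda>x. A x * B' x + A' x * B x) (\<lambda>x. B x * B' x)
      = frac n V (\<lambda>x. F x * G' x + F' x * G x) (\<lambda>x. G x * G' x)"
    if h: "(A, B) \<in> frac n V F G" and h': "(A', B') \<in> frac n V F' G'" for A B A' B'
  proof -
    have fr: "(A, B) \<in> fractions n V" "(A', B') \<in> fractions n V"
      using h h' by (auto simp: mem_frac_iff)
    have "(A x * B' x + A' x * B x) * (G x * G' x) = (F x * G' x + F' x * G x) * (B x * B' x)"
      if "P \<in> V" "x \<in> P" for P x
    proof -
      have "A x * G x = F x * B x" "A' x * G' x = F' x * B' x"
        using h h' that frac_eq_iff[OF fr(1) assms(1)] frac_eq_iff[OF fr(2) assms(2)]
        by (auto simp: mem_frac_iff)
      then have "(A x * G x) * (B' x * G' x) + (A' x * G' x) * (B x * G x)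
          = (F x * B x) * (B' x * G' x) + (F' x * B' x) * (B x * G x)" by simp
      then show ?thesis by (simp add: algebra_simps)
    qed
    then show ?thesis
      using frac_eq_iff[OF fractions_add[OF fr] fractions_add[OF assms]] by simp
  qed
  show ?thesis
    unfolding function_field_def ring.simps
    by (rule UN_pairs_eq[OF frac_self[OF assms(1)] frac_self[OF assms(2)] *])
qed

lemma one_eq: "\<one>\<^bsub>K\<^esub> = frac n V (\<lambda>_. 1) (\<lambda>_. 1)"
  and zero_eq: "\<zero>\<^bsub>K\<^esub> = frac n V (\<lambda>_. 0) (\<lambda>_. 1)"
  unfolding function_field_def by simp_all

lemma frac_eq_zero_iff:
  assumes "(F, G) \<in> fractions n V"
  shows "frac n V F G = \<zero>\<^bsub>K\<^esub> \<longleftrightarrow> vanishes_on F V"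
  unfolding zero_eq frac_eq_iff[OF assms fractions_const] vanishes_on_def by simp

lemma frac_eq_one:
  assumes "(G, G) \<in> fractions n V"
  shows "frac n V G G = \<one>\<^bsub>K\<^esub>"
  unfolding one_eq frac_eq_iff[OF assms fractions_const] by simp

lemma fractions_swap:
  assumes "(F, G) \<in> fractions n V" and "\<not> vanishes_on F V"
  shows "(G, F) \<in> fractions n V"
  using assms unfolding fractions_iff by blast

lemma frac_mult_swap:
  assumes "(F, G) \<in> fractions n V" and "\<not> vanishes_on F V"
  shows "frac n V F G \<otimes>\<^bsub>K\<^esub> frac n V G F = \<one>\<^bsub>K\<^esub>"
proof -
  note sw = fractions_swap[OF assms]
  have "(\<lambda>x. F x * G x) = (\<lambda>x. G x * F x)" by (simp add: mult.commute)
  then show ?thesis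
    using frac_mult[OF assms(1) sw] frac_eq_one[of "\<lambda>x. F x * G x"] fractions_mult[OF assms(1) sw]
    by simp
qed

sublocale field K
proof -
  have "cring K"
  proof (rule cringI)
    show "abelian_group K"
    proof (rule abelian_groupI)
      fix x y assume x: "x \<in> carrier K" and y: "y \<in> carrier K"
      then show "x \<oplus>\<^bsub>K\<^esub> y \<in> carrier K"
        by (elim function_field_cases) (simp add: frac_add frac_closed fractions_add)
      show "x \<oplus>\<^bsub>K\<^esub> y = y \<oplus>\<^bsub>K\<^esub> x"
        using x y by (elim function_field_cases) (simp add: frac_add frac_eq_iff fractions_add)
      fix z assume z: "z \<in> carrier K"
      show "(x \<oplus>\<^bsub>K\<^esub> y) \<oplus>\<^bsub>K\<^esub> z = x \<oplus>\<^bsub>K\<^esub> (y \<oplus>\<^bsub>K\<^esub> z)"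
        using x y z
        by (elim function_field_cases) (simp add: frac_add frac_eq_iff fractions_add, simp add: algebra_simps)
    next
      show "\<zero>\<^bsub>K\<^esub> \<in> carrier K" by (simp add: zero_eq frac_closed fractions_const)
      fix x assume x: "x \<in> carrier K"
      then show "\<zero>\<^bsub>K\<^esub> \<oplus>\<^bsub>K\<^esub> x = x"
        by (elim function_field_cases) (simp add: zero_eq frac_add fractions_const)
      from x obtain F G where FG: "x = frac n V F G" "(F, G) \<in> fractions n V"
        by (rule function_field_cases)
      then have n: "(\<lambda>x. - 1 * F x, G) \<in> fractions n V"
        using is_form_scale unfolding fractions_iff by blast
      have "frac n V (\<lambda>x. - 1 * F x) G \<oplus>\<^bsub>K\<^esub> x = \<zero>\<^bsub>K\<^esub>"
        using frac_eq_zero_iff[OF fractions_add[OF n FG(2)]]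
        unfolding FG(1) frac_add[OF n FG(2)] by (simp add: vanishes_on_def)
      then show "\<exists>y\<in>carrier K. y \<oplus>\<^bsub>K\<^esub> x = \<zero>\<^bsub>K\<^esub>" using frac_closed[OF n] by blast
    qed
    show "Group.comm_monoid K"
    proof (rule comm_monoidI)
      fix x y assume x: "x \<in> carrier K" and y: "y \<in> carrier K"
      then show "x \<otimes>\<^bsub>K\<^esub> y \<in> carrier K"
        by (elim function_field_cases) (simp add: frac_mult frac_closed fractions_mult)
      show "x \<otimes>\<^bsub>K\<^esub> y = y \<otimes>\<^bsub>K\<^esub> x"
        using x y by (elim function_field_cases) (simp add: frac_mult frac_eq_iff fractions_mult)
      fix z assume z: "z \<in> carrier K"
      show "(x \<otimes>\<^bsub>K\<^esub> y) \<otimes>\<^bsub>K\<^esub> z = x \<otimes>\<^bsub>K\<^esub> (y \<otimes>\<^bsub>K\<^esub> z)"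
        using x y z
        by (elim function_field_cases) (simp add: frac_mult frac_eq_iff fractions_mult mult.assoc)
    next
      show "\<one>\<^bsub>K\<^esub> \<in> carrier K" by (simp add: one_eq frac_closed fractions_const)
      fix x assume x: "x \<in> carrier K"
      then show "\<one>\<^bsub>K\<^esub> \<otimes>\<^bsub>K\<^esub> x = x"
        by (elim function_field_cases) (simp add: one_eq frac_mult fractions_const)
    qed
    fix x y z assume "x \<in> carrier K" "y \<in> carrier K" "z \<in> carrier K"
    then show "(x \<oplus>\<^bsub>K\<^esub> y) \<otimes>\<^bsub>K\<^esub> z = x \<otimes>\<^bsub>K\<^esub> z \<oplus>\<^bsub>K\<^esub> y \<otimes>\<^bsub>K\<^esub> z"
      by (elim function_field_cases)
        (simp add: frac_mult frac_add frac_eq_iff fractions_mult fractions_add, simp add: algebra_simps)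
  qed
  then show "field K"
  proof (rule cring.cring_fieldI2)
    show "\<zero>\<^bsub>K\<^esub> \<noteq> \<one>\<^bsub>K\<^esub>"
      using frac_eq_zero_iff[OF fractions_const, of 1] not_vanishes_const[of 1]
      unfolding one_eq by simp
    fix x assume x: "x \<in> carrier K" "x \<noteq> \<zero>\<^bsub>K\<^esub>"
    then obtain F G where FG: "x = frac n V F G" "(F, G) \<in> fractions n V"
      by (elim function_field_cases)
    then show "\<exists>y\<in>carrier K. x \<otimes>\<^bsub>K\<^esub> y = \<one>\<^bsub>K\<^esub>"
      using frac_mult_swap fractions_swap frac_closed x frac_eq_zero_iff by metis
  qed
qed

end

section \<open>Local rings and restriction\<close>

context irreducible_locus
begin

abbreviation local_functions :: "point set \<Rightarrow> ratfun set" where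
  "local_functions W \<equiv> carrier (local_ring n V W)"

lemma local_functions_iff:
  "\<phi> \<in> local_functions W \<longleftrightarrow>
     (\<exists>F G. \<phi> = frac n V F G \<and> (F, G) \<in> fractions n V \<and> \<not> vanishes_on G W)"
proof -
  have "\<phi> \<in> local_functions W \<longleftrightarrow> \<phi> \<in> carrier K \<and> (\<exists>F G. (F, G) \<in> \<phi> \<and> \<not> vanishes_on G W)"
    unfolding local_ring_def by auto
  then show ?thesis using mem_carrier_iff[of \<phi>] frac_closed[of _ _] by blast
qed

lemma local_ideal_iff:
  "\<phi> \<in> local_ideal n V W Z \<longleftrightarrow>
     (\<exists>F G. \<phi> = frac n V F G \<and> (F, G) \<in> fractions n V \<and> \<not> vanishes_on G W \<and> vanishes_on F Z)"
proof -
  have "\<phi> \<in> local_ideal n V W Z \<longleftrightarrow>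
      \<phi> \<in> carrier K \<and> (\<exists>F G. (F, G) \<in> \<phi> \<and> \<not> vanishes_on G W \<and> vanishes_on F Z)"
    unfolding local_ideal_def by auto
  then show ?thesis using mem_carrier_iff[of \<phi>] frac_closed[of _ _] by blast
qed

lemma local_functions_frac:
  "(F, G) \<in> fractions n V \<Longrightarrow> \<not> vanishes_on G W \<Longrightarrow> frac n V F G \<in> local_functions W"
  unfolding local_functions_iff by blast

lemma local_functions_subset: "local_functions W \<subseteq> carrier K"
  unfolding local_ring_def by auto

lemma local_functions_mono: "W \<subseteq> Z \<Longrightarrow> local_functions W \<subseteq> local_functions Z"
  unfolding local_functions_iff subset_iff using vanishes_on_mono by blast

lemma local_ring_eq: "local_ring n V W = K\<lparr>carrier := local_functions W\<rparr>"
  unfolding local_ring_def by simp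

lemma local_ring_simps [simp]:
  "monoid.mult (local_ring n V W) = monoid.mult K"
  "\<one>\<^bsub>local_ring n V W\<^esub> = \<one>\<^bsub>K\<^esub>"
  "\<zero>\<^bsub>local_ring n V W\<^esub> = \<zero>\<^bsub>K\<^esub>"
  unfolding local_ring_def by simp_all

lemma pow_local_ring [simp]: "x [^]\<^bsub>local_ring n V W\<^esub> (k::nat) = x [^]\<^bsub>K\<^esub> k"
  by (subst local_ring_eq) (rule nat_pow_consistent[symmetric])

text \<open>
  The denominators admitted at \<open>W\<close> are closed under multiplication because \<open>W\<close> is irreducible.
\<close>

lemma subring_local_functions:
  assumes "irreducible_locus n W"
  shows "subring (local_functions W) K"
proof (rule subringI)
  interpret W: irreducible_locus n W by fact
  have nv: "\<not> vanishes_on (\<lambda>x. G x * G' x) W"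
    if "(F, G) \<in> fractions n V" "(F', G') \<in> fractions n V" "\<not> vanishes_on G W" "\<not> vanishes_on G' W"
    for F G F' G'
    using that W.vanishes_mult_iff unfolding fractions_iff by blast
  show "local_functions W \<subseteq> carrier K" by (rule local_functions_subset)
  show "\<one>\<^bsub>K\<^esub> \<in> local_functions W"
    unfolding one_eq using fractions_const W.not_vanishes_const[of 1] by (auto intro: local_functions_frac)
  show "\<phi> \<otimes>\<^bsub>K\<^esub> \<psi> \<in> local_functions W" "\<phi> \<oplus>\<^bsub>K\<^esub> \<psi> \<in> local_functions W"
    if f: "\<phi> \<in> local_functions W" "\<psi> \<in> local_functions W" for \<phi> \<psi>
  proof -
    obtain F G F' G' where fr: "\<phi> = frac n V F G" "\<psi> = frac n V F' G'" "(F, G) \<in> fractions n V"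
      "(F', G') \<in> fractions n V" "\<not> vanishes_on G W" "\<not> vanishes_on G' W"
      using f unfolding local_functions_iff by blast
    show "\<phi> \<otimes>\<^bsub>K\<^esub> \<psi> \<in> local_functions W" "\<phi> \<oplus>\<^bsub>K\<^esub> \<psi> \<in> local_functions W"
      unfolding fr(1,2) frac_mult[OF fr(3,4)] frac_add[OF fr(3,4)]
      by (intro local_functions_frac fractions_mult fractions_add fr nv[OF fr(3-6)])+
  qed
  show "\<ominus>\<^bsub>K\<^esub> \<phi> \<in> local_functions W" if f: "\<phi> \<in> local_functions W" for \<phi>
  proof -
    obtain F G where fr: "\<phi> = frac n V F G" "(F, G) \<in> fractions n V" "\<not> vanishes_on G W"
      using f unfolding local_functions_iff by blast
    then have n: "(\<lambda>x. - 1 * F x, G) \<in> fractions n V"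
      using is_form_scale unfolding fractions_iff by blast
    have "frac n V (\<lambda>x. - 1 * F x) G \<oplus>\<^bsub>K\<^esub> \<phi> = \<zero>\<^bsub>K\<^esub>"
      using frac_eq_zero_iff[OF fractions_add[OF n fr(2)]]
      unfolding fr(1) frac_add[OF n fr(2)] by (simp add: vanishes_on_def)
    then have "\<ominus>\<^bsub>K\<^esub> \<phi> = frac n V (\<lambda>x. - 1 * F x) G"
      using minus_equality frac_closed[OF n] local_functions_subset f by blast
    then show ?thesis using local_functions_frac[OF n fr(3)] by simp
  qed
qed

lemma local_functions_mult:
  assumes "irreducible_locus n W" and "\<phi> \<in> local_functions W" and "\<psi> \<in> local_functions W"
  shows "\<phi> \<otimes>\<^bsub>K\<^esub> \<psi> \<in> local_functions W"
  using subringE(6)[OF subring_local_functions] assms by blast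

lemma local_functions_one:
  assumes "irreducible_locus n W"
  shows "\<one>\<^bsub>K\<^esub> \<in> local_functions W"
  using subringE(3)[OF subring_local_functions] assms by blast

lemma local_functions_pow:
  assumes "irreducible_locus n W" and "\<phi> \<in> local_functions W"
  shows "\<phi> [^]\<^bsub>K\<^esub> (k::nat) \<in> local_functions W"
  using assms by (induction k) (auto intro: local_functions_mult local_functions_one)

lemma cring_local_ring:
  assumes "irreducible_locus n W"
  shows "cring (local_ring n V W)"
  using domain.axioms(1)[OF subring_is_domain[OF subring_local_functions[OF assms]]]
  by (simp flip: local_ring_eq)

lemma Units_local_ring_iff:
  "\<phi> \<in> Units (local_ring n V W) \<longleftrightarrow>
     \<phi> \<in> local_functions W \<and> \<phi> \<noteq> \<zero>\<^bsub>K\<^esub> \<and> inv\<^bsub>K\<^esub> \<phi> \<in> local_functions W"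
proof
  assume "\<phi> \<in> Units (local_ring n V W)"
  then obtain \<psi> where \<psi>: "\<phi> \<in> local_functions W" "\<psi> \<in> local_functions W"
      "\<psi> \<otimes>\<^bsub>K\<^esub> \<phi> = \<one>\<^bsub>K\<^esub>" "\<phi> \<otimes>\<^bsub>K\<^esub> \<psi> = \<one>\<^bsub>K\<^esub>"
    unfolding Units_def by auto
  then have c: "\<phi> \<in> carrier K" "\<psi> \<in> carrier K" using local_functions_subset by auto
  have "inv\<^bsub>K\<^esub> \<phi> = \<psi>" using comm_inv_char[OF c \<psi>(4)] .
  moreover have "\<phi> \<noteq> \<zero>\<^bsub>K\<^esub>" using \<psi>(4) c by auto
  ultimately show "\<phi> \<in> local_functions W \<and> \<phi> \<noteq> \<zero>\<^bsub>K\<^esub> \<and> inv\<^bsub>K\<^esub> \<phi> \<in> local_functions W"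
    using \<psi> by simp
next
  assume u: "\<phi> \<in> local_functions W \<and> \<phi> \<noteq> \<zero>\<^bsub>K\<^esub> \<and> inv\<^bsub>K\<^esub> \<phi> \<in> local_functions W"
  then have "\<phi> \<in> Units K" using local_functions_subset field_Units by auto
  then show "\<phi> \<in> Units (local_ring n V W)"
    using u Units_l_inv[of \<phi>] Units_r_inv[of \<phi>] unfolding Units_def[of "local_ring n V W"]
    by (intro CollectI conjI bexI[of _ "inv\<^bsub>K\<^esub> \<phi>"]) simp_all
qed

lemma Units_local_ring_mono:
  "W \<subseteq> Z \<Longrightarrow> \<phi> \<in> Units (local_ring n V W) \<Longrightarrow> \<phi> \<in> Units (local_ring n V Z)"
  unfolding Units_local_ring_iff using local_functions_mono by blast

end

text \<open>
  An ambient \<open>V\<close> and a sublocus \<open>Z\<close>. Restriction to \<open>Z\<close> is the passage from the local ring along \<open>Z\<close>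
  to its residue field, the function field of \<open>Z\<close>.
\<close>

locale irreducible_sublocus = irreducible_locus n V + Z: irreducible_locus n Z
  for n :: nat and V Z :: "point set" +
  assumes sublocus: "Z \<subseteq> V"
begin

abbreviation res :: "ratfun \<Rightarrow> ratfun" where "res \<equiv> restrict_ratfun n Z"

lemma fractions_sublocus:
  "(F, G) \<in> fractions n V \<Longrightarrow> \<not> vanishes_on G Z \<Longrightarrow> (F, G) \<in> fractions n Z"
  unfolding fractions_iff Z.fractions_iff by blast

lemma restrict_frac:
  assumes "(F, G) \<in> fractions n V" and "\<not> vanishes_on G Z"
  shows "res (frac n V F G) = frac n Z F G"
proof -
  have *: "frac n Z F' G' = frac n Z F G" if h: "(F', G') \<in> frac n V F G" and nv: "\<not> vanishes_on G' Z"
    for F' G'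
  proof -
    have fr: "(F', G') \<in> fractions n V" and "frac n V F' G' = frac n V F G"
      using h unfolding mem_frac_iff by simp_all
    then have "\<forall>P\<in>V. \<forall>x\<in>P. F' x * G x = F x * G' x"
      using frac_eq_iff[OF fr assms(1)] by simp
    then have "\<forall>P\<in>Z. \<forall>x\<in>P. F' x * G x = F x * G' x"
      using sublocus by (meson subsetD)
    then show ?thesis
      unfolding Z.frac_eq_iff[OF fractions_sublocus[OF fr nv] fractions_sublocus[OF assms]] .
  qed
  have "(F, G) \<in> {(F', G') \<in> frac n V F G. \<not> vanishes_on G' Z}"
    using frac_self[OF assms(1)] assms(2) by simp
  then show ?thesis unfolding restrict_ratfun_def by (rule UN_pair_eq) (rule *, simp_all)
qed

lemma local_functions_sublocusE:
  assumes "\<phi> \<in> local_functions Z"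
  obtains F G where "\<phi> = frac n V F G" and "(F, G) \<in> fractions n V" and "\<not> vanishes_on G Z"
    and "(F, G) \<in> fractions n Z" and "res \<phi> = frac n Z F G"
  using assms restrict_frac fractions_sublocus unfolding local_functions_iff by blast

lemma restrict_closed: "\<phi> \<in> local_functions Z \<Longrightarrow> res \<phi> \<in> carrier Z.K"
  using Z.frac_closed by (metis local_functions_sublocusE)

lemma restrict_local_functions:
  assumes "W \<subseteq> Z" and "\<phi> \<in> local_functions W"
  shows "res \<phi> \<in> Z.local_functions W"
proof -
  obtain F G where fr: "\<phi> = frac n V F G" "(F, G) \<in> fractions n V" "\<not> vanishes_on G W"
    using assms(2) unfolding local_functions_iff by blast
  moreover from this have "\<not> vanishes_on G Z" using assms(1) vanishes_on_mono by blast
  ultimately show ?thesis using restrict_frac Z.local_functions_frac fractions_sublocus by simp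
qed

lemma restrict_mult:
  assumes "\<phi> \<in> local_functions Z" and "\<psi> \<in> local_functions Z"
  shows "res (\<phi> \<otimes>\<^bsub>K\<^esub> \<psi>) = res \<phi> \<otimes>\<^bsub>Z.K\<^esub> res \<psi>"
proof -
  obtain F G where 1: "\<phi> = frac n V F G" "(F, G) \<in> fractions n V" "\<not> vanishes_on G Z"
     "(F, G) \<in> fractions n Z" "res \<phi> = frac n Z F G"
    using assms(1) by (rule local_functions_sublocusE)
  obtain F' G' where 2: "\<psi> = frac n V F' G'" "(F', G') \<in> fractions n V" "\<not> vanishes_on G' Z"
     "(F', G') \<in> fractions n Z" "res \<psi> = frac n Z F' G'"
    using assms(2) by (rule local_functions_sublocusE)
  have "\<not> vanishes_on (\<lambda>x. G x * G' x) Z"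
    using Z.fractions_mult[OF 1(4) 2(4)] Z.fractions_iff by simp
  then show ?thesis
    unfolding 1(5) 2(5) unfolding 1(1) 2(1) frac_mult[OF 1(2) 2(2)] Z.frac_mult[OF 1(4) 2(4)]
    by (rule restrict_frac[OF fractions_mult[OF 1(2) 2(2)]])
qed

lemma restrict_one: "res \<one>\<^bsub>K\<^esub> = \<one>\<^bsub>Z.K\<^esub>"
  unfolding one_eq Z.one_eq using fractions_const Z.not_vanishes_const[of 1] by (intro restrict_frac) auto

text \<open>
  This turns membership in the ideal of \<open>Z\<close> into a condition in the function field of \<open>Z\<close>, whatever
  \<open>W\<close> the ideal is taken at; the case \<open>W = Z\<close> describes the maximal ideal.
\<close>

lemma restrict_eq_zero_iff:
  assumes "W \<subseteq> Z" and "\<phi> \<in> local_functions W"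
  shows "res \<phi> = \<zero>\<^bsub>Z.K\<^esub> \<longleftrightarrow> \<phi> \<in> local_ideal n V W Z"
proof -
  have *: "vanishes_on F Z \<longleftrightarrow> res \<phi> = \<zero>\<^bsub>Z.K\<^esub>"
    if fr: "\<phi> = frac n V F G" "(F, G) \<in> fractions n V" "\<not> vanishes_on G W" for F G
  proof -
    have nv: "\<not> vanishes_on G Z" using fr(3) assms(1) vanishes_on_mono by blast
    show ?thesis
      unfolding fr(1) restrict_frac[OF fr(2) nv] Z.frac_eq_zero_iff[OF fractions_sublocus[OF fr(2) nv]] ..
  qed
  obtain F G where fr: "\<phi> = frac n V F G" "(F, G) \<in> fractions n V" "\<not> vanishes_on G W"
    using assms(2) unfolding local_functions_iff by blast
  show ?thesis
  proof
    assume "res \<phi> = \<zero>\<^bsub>Z.K\<^esub>"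
    then have "vanishes_on F Z" using *[OF fr] by simp
    then show "\<phi> \<in> local_ideal n V W Z" unfolding local_ideal_iff using fr by blast
  next
    assume "\<phi> \<in> local_ideal n V W Z"
    then obtain F' G' where fr': "\<phi> = frac n V F' G'" "(F', G') \<in> fractions n V"
        "\<not> vanishes_on G' W" "vanishes_on F' Z"
      unfolding local_ideal_iff by blast
    then show "res \<phi> = \<zero>\<^bsub>Z.K\<^esub>" using *[OF fr'(1-3)] by simp
  qed
qed

lemma restrict_Units:
  assumes "W \<subseteq> Z" and "\<phi> \<in> Units (local_ring n V W)"
  shows "res \<phi> \<in> Units (local_ring n Z W)"
proof -
  obtain \<psi> where \<psi>: "\<phi> \<in> local_functions W" "\<psi> \<in> local_functions W"
      "\<phi> \<otimes>\<^bsub>K\<^esub> \<psi> = \<one>\<^bsub>K\<^esub>" "\<psi> \<otimes>\<^bsub>K\<^esub> \<phi> = \<one>\<^bsub>K\<^esub>"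
    using assms(2) unfolding Units_def by auto
  then have "\<phi> \<in> local_functions Z" "\<psi> \<in> local_functions Z"
    using local_functions_mono[OF assms(1)] by auto
  then have "res \<phi> \<otimes>\<^bsub>Z.K\<^esub> res \<psi> = \<one>\<^bsub>Z.K\<^esub>" "res \<psi> \<otimes>\<^bsub>Z.K\<^esub> res \<phi> = \<one>\<^bsub>Z.K\<^esub>"
    using \<psi>(3,4) restrict_mult restrict_one by metis+
  then show ?thesis
    using restrict_local_functions[OF assms(1)] \<psi>(1,2) unfolding Units_def by auto
qed

end

lemma (in cring) cgenideal_pow:
  assumes "g \<in> carrier R"
  shows "PIdl g [^]\<^bsub>ideals_set R\<^esub> (k::nat) = PIdl (g [^] k)"
proof (induction k)
  case 0
  have "PIdl \<one> = carrier R" unfolding cgenideal_def by force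
  then show ?case by (simp add: ideals_set_def)
next
  case (Suc k)
  have c: "g [^] k \<in> carrier R" using assms by simp
  have I: "ideal (PIdl (g [^] Suc k)) R" using assms by (intro cgenideal_ideal) simp
  have "ideal_prod R (PIdl (g [^] k)) (PIdl g) = Idl (PIdl (g [^] Suc k))"
    using ideal_prod_eq_genideal[OF cgenideal_ideal[OF c] cgenideal_ideal[OF assms]]
      cgenideal_prod[OF c assms] by simp
  also have "\<dots> = PIdl (g [^] Suc k)"
    using I genideal_minimal[OF I subset_refl] genideal_self[of "PIdl (g [^] Suc k)"]
      additive_subgroup.a_subset[OF ideal.axioms(1)[OF I]] by blast
  moreover have "PIdl g [^]\<^bsub>ideals_set R\<^esub> Suc k
      = ideal_prod R (PIdl g [^]\<^bsub>ideals_set R\<^esub> k) (PIdl g)"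
    by (simp add: ideals_set_def)
  ultimately show ?case unfolding Suc.IH by simp
qed

context irreducible_sublocus
begin

text \<open>
  Given \<open>F/G\<close> with \<open>F\<close> vanishing on \<open>Z\<close>, exchange the denominator for a power of a coordinate that does
  not vanish on \<open>W\<close>. The new fraction lies in the ideal of \<open>Z\<close> at \<open>W\<close>, so it is a multiple of \<open>g\<close>, and
  the quotient of the two denominators is regular along \<open>Z\<close>.
\<close>

lemma local_ideal_eq_PIdl:
  assumes W: "irreducible_locus n W" "W \<subseteq> Z"
    and g: "g \<in> local_functions W" "PIdl\<^bsub>local_ring n V W\<^esub> g = local_ideal n V W Z"
  shows "local_ideal n V Z Z = PIdl\<^bsub>local_ring n V Z\<^esub> g"
proof
  interpret W: irreducible_locus n W by fact
  note gZ = local_functions_mono[OF W(2), THEN subsetD, OF g(1)]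
  have "g \<in> PIdl\<^bsub>local_ring n V W\<^esub> g"
    using ring.cgenideal_self[OF cring.axioms(1)[OF cring_local_ring[OF W(1)]] g(1)] .
  then have "res g = \<zero>\<^bsub>Z.K\<^esub>" unfolding g(2) restrict_eq_zero_iff[OF W(2) g(1), symmetric] .
  show "PIdl\<^bsub>local_ring n V Z\<^esub> g \<subseteq> local_ideal n V Z Z"
  proof
    fix \<phi> assume "\<phi> \<in> PIdl\<^bsub>local_ring n V Z\<^esub> g"
    then obtain u where u: "u \<in> local_functions Z" "\<phi> = u \<otimes>\<^bsub>K\<^esub> g"
      unfolding cgenideal_def by auto
    then have "res \<phi> = \<zero>\<^bsub>Z.K\<^esub>" using restrict_mult[OF u(1) gZ] \<open>res g = _\<close> restrict_closed by simp
    moreover have "\<phi> \<in> local_functions Z"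
      unfolding u(2) using local_functions_mult[OF Z.irreducible_locus_axioms u(1) gZ] .
    ultimately show "\<phi> \<in> local_ideal n V Z Z" using restrict_eq_zero_iff[OF subset_refl] by simp
  qed
  show "local_ideal n V Z Z \<subseteq> PIdl\<^bsub>local_ring n V Z\<^esub> g"
  proof
    fix \<phi> assume "\<phi> \<in> local_ideal n V Z Z"
    then obtain F G where fr: "\<phi> = frac n V F G" "(F, G) \<in> fractions n V"
        "\<not> vanishes_on G Z" "vanishes_on F Z"
      unfolding local_ideal_iff by blast
    then obtain e where e: "is_form n e F" "is_form n e G" unfolding fractions_iff by blast
    obtain P where P: "P \<in> W" using W.locus_nonempty by blast
    then have "P \<in> proj_space n" using W.locus_subset by blast
    then obtain z where z: "P = {y. \<exists>c. c \<noteq> 0 \<and> y = (\<lambda>i. c * z i)}" "\<exists>i. z i \<noteq> 0" "\<forall>i>n. z i = 0"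
      unfolding proj_space_def by blast
    then obtain i where i: "z i \<noteq> 0" by blast
    have "z \<in> P" unfolding z(1) by (rule CollectI, rule exI[of _ 1]) simp
    have "i \<le> n" using i z(3) by (metis leI)
    define H where "H = (\<lambda>x :: nat \<Rightarrow> complex. x i ^ e)"
    have H: "is_form n e H" unfolding H_def using \<open>i \<le> n\<close> by (rule is_form_coordinate_power)
    have "H z \<noteq> 0" unfolding H_def using i by simp
    then have nvH: "\<not> vanishes_on H W" using \<open>z \<in> P\<close> P unfolding vanishes_on_def by blast
    have "\<not> vanishes_on H V"
      using vanishes_on_mono[of H V W, OF _ subset_trans[OF W(2) sublocus]] nvH by argo
    then have FH: "(F, H) \<in> fractions n V" using e(1) H unfolding fractions_iff by blast
    have HG: "(H, G) \<in> fractions n V" using e(2) H fr(2) unfolding fractions_iff by blast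
    have "frac n V F H \<in> PIdl\<^bsub>local_ring n V W\<^esub> g"
      unfolding g(2) local_ideal_iff using FH nvH fr(4) by (intro exI[of _ F] exI[of _ H]) simp
    then obtain u where u: "u \<in> local_functions W" "frac n V F H = u \<otimes>\<^bsub>K\<^esub> g"
      unfolding cgenideal_def by auto
    have hg: "frac n V H G \<in> local_functions Z" using HG fr(3) by (rule local_functions_frac)
    have "\<phi> = frac n V H G \<otimes>\<^bsub>K\<^esub> frac n V F H"
      unfolding fr(1) frac_mult[OF HG FH] frac_eq_iff[OF fr(2) fractions_mult[OF HG FH]] by simp
    also have "\<dots> = (frac n V H G \<otimes>\<^bsub>K\<^esub> u) \<otimes>\<^bsub>K\<^esub> g"
      unfolding u(2) by (intro m_assoc[symmetric]; rule local_functions_subset[THEN subsetD]) (rule hg u(1) gZ)+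
    finally have "\<phi> = (frac n V H G \<otimes>\<^bsub>K\<^esub> u) \<otimes>\<^bsub>K\<^esub> g" .
    moreover have "frac n V H G \<otimes>\<^bsub>K\<^esub> u \<in> local_functions Z"
      using local_functions_mult[OF Z.irreducible_locus_axioms hg] u(1) local_functions_mono[OF W(2)] by blast
    ultimately show "\<phi> \<in> PIdl\<^bsub>local_ring n V Z\<^esub> g" unfolding cgenideal_def by auto
  qed
qed

end

section \<open>Orders of vanishing\<close>

context irreducible_sublocus
begin

lemma local_functions_carrier: "\<phi> \<in> local_functions W \<Longrightarrow> \<phi> \<in> carrier K"
  using local_functions_subset by blast

lemma pow_nonzero:
  "x \<in> carrier K \<Longrightarrow> x \<noteq> \<zero>\<^bsub>K\<^esub> \<Longrightarrow> x [^]\<^bsub>K\<^esub> (k::nat) \<noteq> \<zero>\<^bsub>K\<^esub>"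
  by (induction k) (auto simp: integral_iff)

lemma local_functions_point_mono: "p \<in> Z \<Longrightarrow> \<phi> \<in> local_functions {p} \<Longrightarrow> \<phi> \<in> local_functions Z"
  using local_functions_mono[of "{p}" Z] by blast

lemma irreducible_point: "p \<in> Z \<Longrightarrow> irreducible_locus n {p}"
  using Z.locus_subset by (intro irreducible_locus_point) blast

lemma local_equation_along:
  assumes p: "p \<in> Z" and g: "local_equation n V Z p g"
  shows "g \<in> local_functions Z" and "res g = \<zero>\<^bsub>Z.K\<^esub>"
    and "local_ideal n V Z Z = PIdl\<^bsub>local_ring n V Z\<^esub> g"
proof -
  note W = irreducible_point[OF p]
  have sub: "{p} \<subseteq> Z" using p by simp
  have g': "g \<in> local_functions {p}" "PIdl\<^bsub>local_ring n V {p}\<^esub> g = local_ideal n V {p} Z"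
    using g unfolding local_equation_def by simp_all
  show "g \<in> local_functions Z" using local_functions_point_mono[OF p g'(1)] .
  show "local_ideal n V Z Z = PIdl\<^bsub>local_ring n V Z\<^esub> g"
    using local_ideal_eq_PIdl[OF W sub g'] .
  have "g \<in> local_ideal n V {p} Z"
    using ring.cgenideal_self[OF cring.axioms(1)[OF cring_local_ring[OF W]] g'(1)] g'(2) by simp
  then show "res g = \<zero>\<^bsub>Z.K\<^esub>" using restrict_eq_zero_iff[OF sub g'(1)] by simp
qed

lemma maximal_ideal_pow_iff:
  assumes "g \<in> local_functions Z" and "local_ideal n V Z Z = PIdl\<^bsub>local_ring n V Z\<^esub> g"
  shows "\<phi> \<in> local_ideal n V Z Z [^]\<^bsub>ideals_set (local_ring n V Z)\<^esub> (k::nat)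
    \<longleftrightarrow> (\<exists>u\<in>local_functions Z. \<phi> = u \<otimes>\<^bsub>K\<^esub> g [^]\<^bsub>K\<^esub> k)"
  unfolding assms(2) cring.cgenideal_pow[OF cring_local_ring[OF Z.irreducible_locus_axioms] assms(1)]
  unfolding cgenideal_def by auto

lemma order_along_zero:
  assumes "p \<in> Z" and "local_equation n V Z p g"
  shows "order_along n V Z \<zero>\<^bsub>K\<^esub> = \<infinity>"
proof -
  note g = local_equation_along[OF assms]
  have "\<zero>\<^bsub>K\<^esub> \<in> local_ideal n V Z Z [^]\<^bsub>ideals_set (local_ring n V Z)\<^esub> k" for k :: nat
    unfolding maximal_ideal_pow_iff[OF g(1,3)]
    using subringE(2)[OF subring_local_functions[OF Z.irreducible_locus_axioms]]
      local_functions_carrier[OF g(1)] by (intro bexI[of _ "\<zero>\<^bsub>K\<^esub>"]) simp_all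
  then have "enat k \<le> order_along n V Z \<zero>\<^bsub>K\<^esub>" for k
    unfolding order_along_def by (intro SUP_upper) simp
  then show ?thesis by (metis enat_ord_simps(2) leD lessI not_infinity_eq)
qed

text \<open>
  The maximal ideal of the local ring along \<open>Z\<close> is generated by \<open>g\<close>, so its powers are generated
  by the powers of \<open>g\<close>. As \<open>g\<close> restricts to zero and \<open>u\<close> does not, \<open>u\<close> is not divisible by \<open>g\<close>.
\<close>

lemma order_along_local_equation_pow:
  assumes "p \<in> Z" and "local_equation n V Z p g"
    and u: "u \<in> local_functions Z" "res u \<noteq> \<zero>\<^bsub>Z.K\<^esub>" and nz: "g \<noteq> \<zero>\<^bsub>K\<^esub> \<or> k = 0"
  shows "order_along n V Z (g [^]\<^bsub>K\<^esub> k \<otimes>\<^bsub>K\<^esub> u) = enat k"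
proof -
  note g = local_equation_along[OF assms(1,2)]
  note [simp] = local_functions_carrier
  have gK: "g \<in> carrier K" using g(1) by simp
  have uK: "u \<in> carrier K" using u(1) by simp
  note pw = local_functions_pow[OF Z.irreducible_locus_axioms g(1)]
  have "{j. g [^]\<^bsub>K\<^esub> k \<otimes>\<^bsub>K\<^esub> u \<in> local_ideal n V Z Z [^]\<^bsub>ideals_set (local_ring n V Z)\<^esub> (j::nat)} = {..k}"
  proof (intro equalityI subsetI)
    fix j :: nat assume "j \<in> {..k}"
    then have "g [^]\<^bsub>K\<^esub> k = g [^]\<^bsub>K\<^esub> (k - j) \<otimes>\<^bsub>K\<^esub> g [^]\<^bsub>K\<^esub> j"
      using nat_pow_mult[OF gK] by simp
    then have "g [^]\<^bsub>K\<^esub> k \<otimes>\<^bsub>K\<^esub> u = (g [^]\<^bsub>K\<^esub> (k - j) \<otimes>\<^bsub>K\<^esub> u) \<otimes>\<^bsub>K\<^esub> g [^]\<^bsub>K\<^esub> j"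
      using gK uK by (simp add: m_ac)
    moreover have "g [^]\<^bsub>K\<^esub> (k - j) \<otimes>\<^bsub>K\<^esub> u \<in> local_functions Z"
      using local_functions_mult[OF Z.irreducible_locus_axioms pw u(1)] .
    ultimately show "j \<in> {j. g [^]\<^bsub>K\<^esub> k \<otimes>\<^bsub>K\<^esub> u \<in> local_ideal n V Z Z [^]\<^bsub>ideals_set (local_ring n V Z)\<^esub> (j::nat)}"
      unfolding mem_Collect_eq maximal_ideal_pow_iff[OF g(1,3)] by blast
  next
    fix j assume "j \<in> {j. g [^]\<^bsub>K\<^esub> k \<otimes>\<^bsub>K\<^esub> u \<in> local_ideal n V Z Z [^]\<^bsub>ideals_set (local_ring n V Z)\<^esub> (j::nat)}"
    then obtain v where v: "v \<in> local_functions Z" "g [^]\<^bsub>K\<^esub> k \<otimes>\<^bsub>K\<^esub> u = v \<otimes>\<^bsub>K\<^esub> g [^]\<^bsub>K\<^esub> j"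
      unfolding mem_Collect_eq maximal_ideal_pow_iff[OF g(1,3)] by blast
    have vK: "v \<in> carrier K" using v(1) by simp
    show "j \<in> {..k}"
    proof (rule ccontr)
      assume "j \<notin> {..k}"
      then obtain i where i: "j = k + Suc i" by (metis atMost_iff add_Suc_right less_imp_Suc_add linorder_not_le)
      define w where "w = v \<otimes>\<^bsub>K\<^esub> g [^]\<^bsub>K\<^esub> i"
      have w: "w \<in> local_functions Z"
        unfolding w_def using local_functions_mult[OF Z.irreducible_locus_axioms v(1) pw] .
      have wK: "w \<in> carrier K" using w by simp
      have "g [^]\<^bsub>K\<^esub> j = g [^]\<^bsub>K\<^esub> k \<otimes>\<^bsub>K\<^esub> (g [^]\<^bsub>K\<^esub> i \<otimes>\<^bsub>K\<^esub> g)"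
        using nat_pow_mult[OF gK, of k "Suc i"] unfolding i by simp
      then have "g [^]\<^bsub>K\<^esub> k \<otimes>\<^bsub>K\<^esub> u = g [^]\<^bsub>K\<^esub> k \<otimes>\<^bsub>K\<^esub> (w \<otimes>\<^bsub>K\<^esub> g)"
        unfolding v(2) w_def using gK vK by (simp add: m_ac)
      moreover have "g [^]\<^bsub>K\<^esub> k \<noteq> \<zero>\<^bsub>K\<^esub>"
        using nz pow_nonzero[OF gK] by (cases "k = 0") auto
      ultimately have "u = w \<otimes>\<^bsub>K\<^esub> g"
        using m_lcancel[of "g [^]\<^bsub>K\<^esub> k" u "w \<otimes>\<^bsub>K\<^esub> g"] gK uK wK by simp
      then have "res u = res w \<otimes>\<^bsub>Z.K\<^esub> \<zero>\<^bsub>Z.K\<^esub>"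
        using restrict_mult[OF w g(1)] g(2) by simp
      then show False using u(2) restrict_closed[OF w] by simp
    qed
  qed
  then have "order_along n V Z (g [^]\<^bsub>K\<^esub> k \<otimes>\<^bsub>K\<^esub> u) = (SUP j\<in>{..k}. enat j)"
    unfolding order_along_def by simp
  also have "\<dots> = enat k"
    by (rule antisym) (auto intro: SUP_least SUP_upper)
  finally show ?thesis .
qed

lemma order_along_finite:
  assumes "p \<in> Z" and "local_equation n V Z p g" and "u \<in> local_functions Z"
    and "order_along n V Z (g [^]\<^bsub>K\<^esub> (k::nat) \<otimes>\<^bsub>K\<^esub> u) \<noteq> \<infinity>"
  shows "g \<noteq> \<zero>\<^bsub>K\<^esub> \<or> k = 0"
proof (rule ccontr)
  assume "\<not> (g \<noteq> \<zero>\<^bsub>K\<^esub> \<or> k = 0)"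
  then have "g [^]\<^bsub>K\<^esub> k \<otimes>\<^bsub>K\<^esub> u = \<zero>\<^bsub>K\<^esub>"
    using local_functions_carrier[OF assms(3)] by (cases k) auto
  then show False using order_along_zero[OF assms(1,2)] assms(4) by simp
qed

lemma order_along_geE:
  assumes "p \<in> Z" and "local_equation n V Z p g" and f: "f \<in> local_functions Z"
    and ge: "enat m \<le> order_along n V Z f"
  obtains u where "u \<in> local_functions Z" and "f = u \<otimes>\<^bsub>K\<^esub> g [^]\<^bsub>K\<^esub> m"
proof -
  note g = local_equation_along[OF assms(1,2)]
  have gK: "g \<in> carrier K" using local_functions_carrier[OF g(1)] .
  let ?J = "{k. f \<in> local_ideal n V Z Z [^]\<^bsub>ideals_set (local_ring n V Z)\<^esub> (k::nat)}"
  have "\<exists>j\<in>?J. m \<le> j"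
  proof (cases m)
    case 0
    have "f = f \<otimes>\<^bsub>K\<^esub> g [^]\<^bsub>K\<^esub> (0::nat)" using local_functions_carrier[OF f] by simp
    then have "0 \<in> ?J" unfolding mem_Collect_eq maximal_ideal_pow_iff[OF g(1,3)] using f by blast
    then show ?thesis using 0 by blast
  next
    case (Suc i)
    show ?thesis
    proof (rule ccontr)
      assume "\<not> (\<exists>j\<in>?J. m \<le> j)"
      then have "enat j \<le> enat i" if "j \<in> ?J" for j using that Suc by (metis enat_ord_simps(1) not_less_eq_eq)
      then have "order_along n V Z f \<le> enat i" unfolding order_along_def by (rule SUP_least)
      then show False using ge Suc by (metis enat_ord_simps(1) not_less_eq_eq order.refl order.trans)
    qed
  qed
  then obtain j where "j \<in> ?J" "m \<le> j" by blast
  then obtain u where u: "u \<in> local_functions Z" "f = u \<otimes>\<^bsub>K\<^esub> g [^]\<^bsub>K\<^esub> j"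
    unfolding mem_Collect_eq maximal_ideal_pow_iff[OF g(1,3)] by blast
  have "g [^]\<^bsub>K\<^esub> j = g [^]\<^bsub>K\<^esub> (j - m) \<otimes>\<^bsub>K\<^esub> g [^]\<^bsub>K\<^esub> m"
    using nat_pow_mult[OF gK] \<open>m \<le> j\<close> by simp
  then have "f = (u \<otimes>\<^bsub>K\<^esub> g [^]\<^bsub>K\<^esub> (j - m)) \<otimes>\<^bsub>K\<^esub> g [^]\<^bsub>K\<^esub> m"
    using u(2) gK local_functions_carrier[OF u(1)] by (simp add: m_assoc)
  moreover have "u \<otimes>\<^bsub>K\<^esub> g [^]\<^bsub>K\<^esub> (j - m) \<in> local_functions Z"
    using local_functions_mult[OF Z.irreducible_locus_axioms u(1)
        local_functions_pow[OF Z.irreducible_locus_axioms g(1)]] .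
  ultimately show thesis using that by blast
qed

text \<open>
  A nonzero local equation is a prime element: a function that is regular at the point and divisible by
  its \<open>m\<close>-th power along \<open>Z\<close> is divisible by it at the point, because each single factor can be
  detected by restricting to \<open>Z\<close>.
\<close>

lemma local_equation_divides:
  assumes p: "p \<in> Z" and g: "local_equation n V Z p g" "g \<noteq> \<zero>\<^bsub>K\<^esub>"
    and "f \<in> local_functions {p}" and u: "u \<in> local_functions Z" and "f = u \<otimes>\<^bsub>K\<^esub> g [^]\<^bsub>K\<^esub> (m::nat)"
  shows "u \<in> local_functions {p}"
  using assms(4,6)
proof (induction m arbitrary: f)
  case 0
  then show ?case using local_functions_carrier[OF u] by simp
next
  case (Suc m)
  note gZ = local_equation_along[OF p g(1)]
  have gK: "g \<in> carrier K" and uK: "u \<in> carrier K"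
    using local_functions_carrier gZ(1) u by blast+
  have um: "u \<otimes>\<^bsub>K\<^esub> g [^]\<^bsub>K\<^esub> m \<in> local_functions Z"
    using local_functions_mult[OF Z.irreducible_locus_axioms u
        local_functions_pow[OF Z.irreducible_locus_axioms gZ(1)]] .
  have f: "f = (u \<otimes>\<^bsub>K\<^esub> g [^]\<^bsub>K\<^esub> m) \<otimes>\<^bsub>K\<^esub> g" using Suc.prems(2) gK uK by (simp add: m_assoc)
  then have "res f = res (u \<otimes>\<^bsub>K\<^esub> g [^]\<^bsub>K\<^esub> m) \<otimes>\<^bsub>Z.K\<^esub> \<zero>\<^bsub>Z.K\<^esub>"
    using restrict_mult[OF um gZ(1)] gZ(2) by simp
  then have "res f = \<zero>\<^bsub>Z.K\<^esub>" using restrict_closed[OF um] by simp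
  then have "f \<in> local_ideal n V {p} Z"
    using restrict_eq_zero_iff[of "{p}" f] p Suc.prems(1) by simp
  then have "f \<in> PIdl\<^bsub>local_ring n V {p}\<^esub> g" using g(1) unfolding local_equation_def by simp
  then obtain h where h: "h \<in> local_functions {p}" "f = h \<otimes>\<^bsub>K\<^esub> g"
    unfolding cgenideal_def by auto
  have "h = u \<otimes>\<^bsub>K\<^esub> g [^]\<^bsub>K\<^esub> m"
    using m_rcancel[of g h "u \<otimes>\<^bsub>K\<^esub> g [^]\<^bsub>K\<^esub> m"] f h(2) g(2) gK uK local_functions_carrier[OF h(1)]
    by simp
  then show ?case using Suc.IH[OF h(1)] by simp
qed

text \<open>
  Each of the two divides the other, and the quotients are inverse to each other unless both are \<open>0\<close>;
  in that case \<open>1\<close> serves as the unit.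
\<close>

lemma local_equation_unique:
  assumes p: "p \<in> Z" and g: "local_equation n V Z p g" and h: "local_equation n V Z p h"
  obtains w where "w \<in> Units (local_ring n V {p})" and "h = g \<otimes>\<^bsub>K\<^esub> w"
proof -
  note W = irreducible_point[OF p]
  have g': "g \<in> local_functions {p}" and h': "h \<in> local_functions {p}"
    and eq: "PIdl\<^bsub>local_ring n V {p}\<^esub> g = PIdl\<^bsub>local_ring n V {p}\<^esub> h"
    using g h unfolding local_equation_def by simp_all
  note self = ring.cgenideal_self[OF cring.axioms(1)[OF cring_local_ring[OF W]]]
  have "h \<in> PIdl\<^bsub>local_ring n V {p}\<^esub> g" "g \<in> PIdl\<^bsub>local_ring n V {p}\<^esub> h"
    using self[OF h'] self[OF g'] eq by simp_all
  then obtain w v where w: "w \<in> local_functions {p}" "h = w \<otimes>\<^bsub>K\<^esub> g"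
      and v: "v \<in> local_functions {p}" "g = v \<otimes>\<^bsub>K\<^esub> h"
    unfolding cgenideal_def by auto
  have c: "g \<in> carrier K" "h \<in> carrier K" "w \<in> carrier K" "v \<in> carrier K"
    using local_functions_carrier g' h' w(1) v(1) by blast+
  show thesis
  proof (cases "g = \<zero>\<^bsub>K\<^esub>")
    case True
    then have "h = g \<otimes>\<^bsub>K\<^esub> \<one>\<^bsub>K\<^esub>" using w(2) c by simp
    moreover have "\<one>\<^bsub>K\<^esub> \<in> Units (local_ring n V {p})"
      unfolding Units_local_ring_iff using local_functions_one[OF W] by simp
    ultimately show thesis using that by blast
  next
    case False
    have "(v \<otimes>\<^bsub>K\<^esub> w) \<otimes>\<^bsub>K\<^esub> g = \<one>\<^bsub>K\<^esub> \<otimes>\<^bsub>K\<^esub> g"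
      using w(2) v(2) c by (simp add: m_assoc)
    then have vw: "v \<otimes>\<^bsub>K\<^esub> w = \<one>\<^bsub>K\<^esub>"
      using m_rcancel[of g "v \<otimes>\<^bsub>K\<^esub> w" "\<one>\<^bsub>K\<^esub>"] False c by simp
    then have wv: "w \<otimes>\<^bsub>K\<^esub> v = \<one>\<^bsub>K\<^esub>" using c m_comm by simp
    have "w \<in> Units (local_ring n V {p})"
      unfolding Units_def using w(1) v(1) vw wv by auto
    then show thesis using that w(2) c m_comm by simp
  qed
qed

end

section \<open>Valuations along a flag\<close>

definition irreducible_flag :: "nat \<Rightarrow> nat \<Rightarrow> (nat \<Rightarrow> point set) \<Rightarrow> bool" where
  "irreducible_flag n d Y \<longleftrightarrow> (\<forall>i\<le>d. irreducible_locus n (Y i)) \<and>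
     (\<forall>i<d. Y (Suc i) \<subseteq> Y i) \<and> (\<exists>p. Y d = {p})"

lemma irreducible_flag_admissible:
  assumes "admissible_flag n X d Y"
  shows "irreducible_flag n d Y"
proof -
  have "\<forall>i\<le>d. projective_variety n (Y i)" "\<forall>i<d. Y (Suc i) \<subseteq> Y i" "\<exists>p. Y d = {p}"
    using assms unfolding admissible_flag_def by auto
  then show ?thesis
    unfolding irreducible_flag_def by (simp add: irreducible_locus_projective_variety)
qed

lemma irreducible_flag_truncated:
  "irreducible_flag n (Suc d) Y \<Longrightarrow> irreducible_flag n d (truncated_flag Y)"
  unfolding irreducible_flag_def truncated_flag_def by auto

lemma flag_point_truncated: "flag_point d (truncated_flag Y) = flag_point (Suc d) Y"
  unfolding flag_point_def truncated_flag_def by simp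

lemma flag_point_mem:
  assumes "irreducible_flag n d Y" and "i \<le> d"
  shows "flag_point d Y \<in> Y i"
proof -
  have "Y d \<subseteq> Y i"
    using assms(2) by (induction rule: inc_induct) (use assms(1) in \<open>auto simp: irreducible_flag_def\<close>)
  moreover have "flag_point d Y \<in> Y d"
    using assms(1) unfolding irreducible_flag_def flag_point_def by auto
  ultimately show ?thesis by blast
qed

lemma irreducible_flag_sublocus:
  assumes "irreducible_flag n (Suc d) Y"
  shows "irreducible_sublocus n (Y 0) (Y 1)"
  using assms unfolding irreducible_flag_def irreducible_sublocus_def irreducible_sublocus_axioms_def by auto

lemma flag_valuation_nonzero:
  assumes "irreducible_flag n d Y" and "flag_valuation n d Y f \<nu>"
  shows "f \<in> carrier (function_field n (Y 0))" and "f \<noteq> \<zero>\<^bsub>function_field n (Y 0)\<^esub>"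
proof (atomize (full), cases d)
  case 0
  then show "f \<in> carrier (function_field n (Y 0)) \<and> f \<noteq> \<zero>\<^bsub>function_field n (Y 0)\<^esub>"
    using assms(2) by simp
next
  case (Suc d')
  interpret irreducible_sublocus n "Y 0" "Y 1"
    using assms(1) unfolding Suc by (rule irreducible_flag_sublocus)
  let ?p = "flag_point d Y"
  have p: "?p \<in> Y 1" using flag_point_mem[OF assms(1), of 1] Suc by simp
  obtain g u where g: "local_equation n (Y 0) (Y 1) ?p g" and u: "u \<in> local_functions {?p}"
      and f: "f = g [^]\<^bsub>K\<^esub> \<nu> 0 \<otimes>\<^bsub>K\<^esub> u" and ord: "order_along n (Y 0) (Y 1) f = enat (\<nu> 0)"
    using assms(2) unfolding Suc by auto
  have "f \<in> carrier K"
    unfolding f using local_functions_carrier u g by (auto simp: local_equation_def)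
  moreover have "f \<noteq> \<zero>\<^bsub>K\<^esub>" using order_along_zero[OF p g] ord by auto
  ultimately show "f \<in> carrier K \<and> f \<noteq> \<zero>\<^bsub>K\<^esub>" by simp
qed

text \<open>
  The restriction of \<open>u\<close> has a valuation, hence is nonzero, so the order of \<open>g ^ \<nu> 0 * u\<close> is \<open>\<nu> 0\<close>
  unless \<open>g = 0\<close> occurs with a positive exponent. The condition on the order can therefore be replaced by one
  that is easy to check for products.
\<close>

lemma flag_valuation_Suc_iff:
  assumes "irreducible_flag n (Suc d) Y"
  shows "flag_valuation n (Suc d) Y f \<nu> \<longleftrightarrow>
    (\<exists>g u. local_equation n (Y 0) (Y 1) (flag_point (Suc d) Y) g \<and>
        (g \<noteq> \<zero>\<^bsub>function_field n (Y 0)\<^esub> \<or> \<nu> 0 = 0) \<and>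
        u \<in> carrier (local_ring n (Y 0) {flag_point (Suc d) Y}) \<and>
        f = g [^]\<^bsub>function_field n (Y 0)\<^esub> \<nu> 0 \<otimes>\<^bsub>function_field n (Y 0)\<^esub> u \<and>
        flag_valuation n d (truncated_flag Y) (restrict_ratfun n (Y 1) u) (\<lambda>i. \<nu> (Suc i)))"
    (is "_ \<longleftrightarrow> ?rhs")
proof -
  interpret irreducible_sublocus n "Y 0" "Y 1"
    using assms by (rule irreducible_flag_sublocus)
  let ?p = "flag_point (Suc d) Y"
  have p: "?p \<in> Y 1" using flag_point_mem[OF assms, of 1] by simp
  note flag = irreducible_flag_truncated[OF assms]
  have "order_along n (Y 0) (Y 1) (g [^]\<^bsub>K\<^esub> \<nu> 0 \<otimes>\<^bsub>K\<^esub> u) = enat (\<nu> 0) \<longleftrightarrow> g \<noteq> \<zero>\<^bsub>K\<^esub> \<or> \<nu> 0 = 0"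
    if g: "local_equation n (Y 0) (Y 1) ?p g" and u: "u \<in> local_functions {?p}"
      and val: "flag_valuation n d (truncated_flag Y) (res u) (\<lambda>i. \<nu> (Suc i))" for g u
  proof
    have uZ: "u \<in> local_functions (Y 1)" using local_functions_point_mono[OF p u] .
    show "order_along n (Y 0) (Y 1) (g [^]\<^bsub>K\<^esub> \<nu> 0 \<otimes>\<^bsub>K\<^esub> u) = enat (\<nu> 0) \<Longrightarrow> g \<noteq> \<zero>\<^bsub>K\<^esub> \<or> \<nu> 0 = 0"
      using order_along_finite[OF p g uZ, of "\<nu> 0"] by simp
    have "res u \<noteq> \<zero>\<^bsub>Z.K\<^esub>"
      using flag_valuation_nonzero(2)[OF flag val] by (simp add: truncated_flag_def)
    then show "g \<noteq> \<zero>\<^bsub>K\<^esub> \<or> \<nu> 0 = 0 \<Longrightarrow> order_along n (Y 0) (Y 1) (g [^]\<^bsub>K\<^esub> \<nu> 0 \<otimes>\<^bsub>K\<^esub> u) = enat (\<nu> 0)"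
      using order_along_local_equation_pow[OF p g uZ] by simp
  qed
  note order_iff = this
  show ?thesis
  proof
    assume "flag_valuation n (Suc d) Y f \<nu>"
    then obtain g u where "local_equation n (Y 0) (Y 1) ?p g" and "u \<in> local_functions {?p}"
        and "f = g [^]\<^bsub>K\<^esub> \<nu> 0 \<otimes>\<^bsub>K\<^esub> u" and "order_along n (Y 0) (Y 1) f = enat (\<nu> 0)"
        and "flag_valuation n d (truncated_flag Y) (res u) (\<lambda>i. \<nu> (Suc i))"
      by auto
    then show ?rhs using order_iff[of g u] by (intro exI[of _ g] exI[of _ u]) simp
  next
    assume ?rhs
    then obtain g u where "local_equation n (Y 0) (Y 1) ?p g" and "u \<in> local_functions {?p}"
        and "f = g [^]\<^bsub>K\<^esub> \<nu> 0 \<otimes>\<^bsub>K\<^esub> u" and "g \<noteq> \<zero>\<^bsub>K\<^esub> \<or> \<nu> 0 = 0"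
        and "flag_valuation n d (truncated_flag Y) (res u) (\<lambda>i. \<nu> (Suc i))"
      by blast
    then show "flag_valuation n (Suc d) Y f \<nu>"
      unfolding flag_valuation.simps using order_iff[of g u]
      by (intro conjI exI[of _ g] exI[of _ u]) simp_all
  qed
qed

text \<open>
  In each step the unit is absorbed by the cofactor of the power of the local equation, and its
  restriction is a unit at the point of the flag again.
\<close>

lemma flag_valuation_mult_unit:
  assumes "irreducible_flag n d Y" and "flag_valuation n d Y f \<nu>"
    and "w \<in> Units (local_ring n (Y 0) {flag_point d Y})"
  shows "flag_valuation n d Y (f \<otimes>\<^bsub>function_field n (Y 0)\<^esub> w) \<nu>"
  using assms
proof (induction d arbitrary: Y f \<nu> w)
  case 0
  interpret irreducible_locus n "Y 0" using 0(1) unfolding irreducible_flag_def by simp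
  have "w \<in> carrier K" "w \<noteq> \<zero>\<^bsub>K\<^esub>"
    using 0(3) local_functions_subset unfolding Units_local_ring_iff by auto
  then show ?case using 0(2) integral_iff[of f w] by simp
next
  case (Suc d)
  interpret irreducible_sublocus n "Y 0" "Y 1"
    using Suc.prems(1) by (rule irreducible_flag_sublocus)
  let ?p = "flag_point (Suc d) Y"
  have p: "?p \<in> Y 1" using flag_point_mem[OF Suc.prems(1), of 1] by simp
  note flag = irreducible_flag_truncated[OF Suc.prems(1)]
  note w = Suc.prems(3)
  then have wp: "w \<in> local_functions {?p}" unfolding Units_local_ring_iff by simp
  obtain g u where g: "local_equation n (Y 0) (Y 1) ?p g" "g \<noteq> \<zero>\<^bsub>K\<^esub> \<or> \<nu> 0 = 0"
      and u: "u \<in> local_functions {?p}" and f: "f = g [^]\<^bsub>K\<^esub> \<nu> 0 \<otimes>\<^bsub>K\<^esub> u"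
      and val: "flag_valuation n d (truncated_flag Y) (res u) (\<lambda>i. \<nu> (Suc i))"
    using Suc.prems(2) unfolding flag_valuation_Suc_iff[OF Suc.prems(1)] by blast
  have gK: "g \<in> carrier K" using g(1) local_functions_carrier unfolding local_equation_def by blast
  have "f \<otimes>\<^bsub>K\<^esub> w = g [^]\<^bsub>K\<^esub> \<nu> 0 \<otimes>\<^bsub>K\<^esub> (u \<otimes>\<^bsub>K\<^esub> w)"
    unfolding f using gK local_functions_carrier[OF u] local_functions_carrier[OF wp] by (simp add: m_assoc)
  moreover have "u \<otimes>\<^bsub>K\<^esub> w \<in> local_functions {?p}"
    using local_functions_mult[OF irreducible_point[OF p] u wp] .
  moreover have "res w \<in> Units (local_ring n (truncated_flag Y 0) {flag_point d (truncated_flag Y)})"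
    using restrict_Units[OF _ w] p unfolding flag_point_truncated by (simp add: truncated_flag_def)
  then have "flag_valuation n d (truncated_flag Y) (res (u \<otimes>\<^bsub>K\<^esub> w)) (\<lambda>i. \<nu> (Suc i))"
    using Suc.IH[OF flag val] restrict_mult[OF local_functions_point_mono[OF p u]
        local_functions_point_mono[OF p wp]] by (simp add: truncated_flag_def)
  ultimately show ?case
    unfolding flag_valuation_Suc_iff[OF Suc.prems(1)] using g by blast
qed

text \<open>
  The two factors may come with different local equations \<open>g\<close> and \<open>g'\<close>. These differ by a unit \<open>w\<close>,
  whose power \<open>v\<close> goes into the cofactor.
\<close>

lemma flag_valuation_mult:
  assumes "irreducible_flag n d Y" and "flag_valuation n d Y f \<nu>" and "flag_valuation n d Y f' \<nu>'"
  shows "flag_valuation n d Y (f \<otimes>\<^bsub>function_field n (Y 0)\<^esub> f') (\<lambda>i. \<nu> i + \<nu>' i)"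
  using assms
proof (induction d arbitrary: Y f \<nu> f' \<nu>')
  case 0
  interpret irreducible_locus n "Y 0" using 0(1) unfolding irreducible_flag_def by simp
  show ?case using 0(2,3) integral_iff[of f f'] by simp
next
  case (Suc d)
  interpret irreducible_sublocus n "Y 0" "Y 1"
    using Suc.prems(1) by (rule irreducible_flag_sublocus)
  let ?p = "flag_point (Suc d) Y"
  have p: "?p \<in> Y 1" using flag_point_mem[OF Suc.prems(1), of 1] by simp
  note flag = irreducible_flag_truncated[OF Suc.prems(1)]
  obtain g u where g: "local_equation n (Y 0) (Y 1) ?p g" "g \<noteq> \<zero>\<^bsub>K\<^esub> \<or> \<nu> 0 = 0"
      and u: "u \<in> local_functions {?p}" and f: "f = g [^]\<^bsub>K\<^esub> \<nu> 0 \<otimes>\<^bsub>K\<^esub> u"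
      and val: "flag_valuation n d (truncated_flag Y) (res u) (\<lambda>i. \<nu> (Suc i))"
    using Suc.prems(2) unfolding flag_valuation_Suc_iff[OF Suc.prems(1)] by blast
  obtain g' u' where g': "local_equation n (Y 0) (Y 1) ?p g'" "g' \<noteq> \<zero>\<^bsub>K\<^esub> \<or> \<nu>' 0 = 0"
      and u': "u' \<in> local_functions {?p}" and f': "f' = g' [^]\<^bsub>K\<^esub> \<nu>' 0 \<otimes>\<^bsub>K\<^esub> u'"
      and val': "flag_valuation n d (truncated_flag Y) (res u') (\<lambda>i. \<nu>' (Suc i))"
    using Suc.prems(3) unfolding flag_valuation_Suc_iff[OF Suc.prems(1)] by blast
  obtain w where w: "w \<in> Units (local_ring n (Y 0) {?p})" "g' = g \<otimes>\<^bsub>K\<^esub> w"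
    using local_equation_unique[OF p g(1) g'(1)] .
  have wp: "w \<in> local_functions {?p}" using w(1) unfolding Units_local_ring_iff by simp
  define v where "v = w [^]\<^bsub>K\<^esub> \<nu>' 0"
  have v: "v \<in> Units (local_ring n (Y 0) {?p})"
    using monoid.Units_pow_closed[OF _ w(1), of "\<nu>' 0"] cring_local_ring[OF irreducible_point[OF p]]
    unfolding v_def by (simp add: cring_def ring_def)
  then have vp: "v \<in> local_functions {?p}" unfolding Units_local_ring_iff by simp
  have c: "g \<in> carrier K" "w \<in> carrier K" "v \<in> carrier K" "u \<in> carrier K" "u' \<in> carrier K"
    using g(1) wp u u' vp local_functions_carrier unfolding local_equation_def by blast+
  have "g' [^]\<^bsub>K\<^esub> \<nu>' 0 = g [^]\<^bsub>K\<^esub> \<nu>' 0 \<otimes>\<^bsub>K\<^esub> v"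
    unfolding w(2) v_def using nat_pow_distrib c by simp
  moreover have "g [^]\<^bsub>K\<^esub> (\<nu> 0 + \<nu>' 0) = g [^]\<^bsub>K\<^esub> \<nu> 0 \<otimes>\<^bsub>K\<^esub> g [^]\<^bsub>K\<^esub> \<nu>' 0"
    using nat_pow_mult[OF c(1)] by simp
  ultimately have "f \<otimes>\<^bsub>K\<^esub> f' = g [^]\<^bsub>K\<^esub> (\<nu> 0 + \<nu>' 0) \<otimes>\<^bsub>K\<^esub> ((u \<otimes>\<^bsub>K\<^esub> u') \<otimes>\<^bsub>K\<^esub> v)"
    unfolding f f' using c by (simp add: m_ac)
  moreover have uu: "u \<otimes>\<^bsub>K\<^esub> u' \<in> local_functions {?p}"
    using local_functions_mult[OF irreducible_point[OF p] u u'] .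
  moreover have "(u \<otimes>\<^bsub>K\<^esub> u') \<otimes>\<^bsub>K\<^esub> v \<in> local_functions {?p}"
    using local_functions_mult[OF irreducible_point[OF p] uu vp] .
  moreover have "g \<noteq> \<zero>\<^bsub>K\<^esub> \<or> \<nu> 0 + \<nu>' 0 = 0"
    using g(2) g'(2) c(2) unfolding w(2) by (cases "g = \<zero>\<^bsub>K\<^esub>") simp_all
  moreover have "flag_valuation n d (truncated_flag Y) (res ((u \<otimes>\<^bsub>K\<^esub> u') \<otimes>\<^bsub>K\<^esub> v)) (\<lambda>i. \<nu> (Suc i) + \<nu>' (Suc i))"
  proof -
    have "res v \<in> Units (local_ring n (truncated_flag Y 0) {flag_point d (truncated_flag Y)})"
      using restrict_Units[OF _ v] p unfolding flag_point_truncated by (simp add: truncated_flag_def)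
    from flag_valuation_mult_unit[OF flag Suc.IH[OF flag val val'] this] show ?thesis
      unfolding restrict_mult[OF local_functions_point_mono[OF p uu] local_functions_point_mono[OF p vp]]
        restrict_mult[OF local_functions_point_mono[OF p u] local_functions_point_mono[OF p u']]
      by (simp add: truncated_flag_def)
  qed
  ultimately show ?case
    unfolding flag_valuation_Suc_iff[OF Suc.prems(1)] using g(1)
    by (intro exI[of _ g] exI[of _ "(u \<otimes>\<^bsub>K\<^esub> u') \<otimes>\<^bsub>K\<^esub> v"] conjI)
qed

lemma flag_valuation_support:
  "flag_valuation n d Y f \<nu> \<Longrightarrow> d \<le> i \<Longrightarrow> \<nu> i = 0"
proof (induction d arbitrary: Y f \<nu> i)
  case (Suc d)
  then show ?case by (cases i) fastforce+
qed simp

section \<open>Rational hyperplane sections of cones over semigroups\<close>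

lemma convex_cone_of_generator:
  assumes "v \<in> \<Gamma>"
  shows "v \<in> convex_cone_of \<Gamma>"
  unfolding convex_cone_of_def using assms
  by (intro CollectI exI[of _ "{v}"] exI[of _ "\<lambda>_. 1"]) simp

lemma convex_cone_of_zero: "(\<lambda>_. 0, 0) \<in> convex_cone_of \<Gamma>"
  unfolding convex_cone_of_def by (intro CollectI exI[of _ "{}"]) simp

lemma convex_cone_of_scale:
  assumes "z \<in> convex_cone_of \<Gamma>" and "0 \<le> r"
  shows "(\<lambda>i. r * fst z i, r * snd z) \<in> convex_cone_of \<Gamma>"
proof -
  obtain A c where z: "z = (\<lambda>i. \<Sum>v\<in>A. c v * fst v i, \<Sum>v\<in>A. c v * snd v)"
      and A: "finite A" "A \<subseteq> \<Gamma>" "\<forall>v\<in>A. c v \<ge> 0"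
    using assms(1) unfolding convex_cone_of_def by blast
  then show ?thesis
    using assms(2) unfolding convex_cone_of_def z
    by (intro CollectI exI[of _ A] exI[of _ "\<lambda>v. r * c v"]) (simp add: sum_distrib_left mult.assoc)
qed

lemma convex_cone_of_add:
  assumes "z \<in> convex_cone_of \<Gamma>" and "w \<in> convex_cone_of \<Gamma>"
  shows "(\<lambda>i. fst z i + fst w i, snd z + snd w) \<in> convex_cone_of \<Gamma>"
proof -
  obtain A c where z: "z = (\<lambda>i. \<Sum>v\<in>A. c v * fst v i, \<Sum>v\<in>A. c v * snd v)"
      and A: "finite A" "A \<subseteq> \<Gamma>" "\<forall>v\<in>A. c v \<ge> 0"
    using assms(1) unfolding convex_cone_of_def by blast
  obtain B c' where w: "w = (\<lambda>i. \<Sum>v\<in>B. c' v * fst v i, \<Sum>v\<in>B. c' v * snd v)"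
      and B: "finite B" "B \<subseteq> \<Gamma>" "\<forall>v\<in>B. c' v \<ge> 0"
    using assms(2) unfolding convex_cone_of_def by blast
  define e where "e = (\<lambda>v. (if v \<in> A then c v else 0) + (if v \<in> B then c' v else 0))"
  have "(\<Sum>v\<in>A \<union> B. e v * f v) = (\<Sum>v\<in>A. c v * f v) + (\<Sum>v\<in>B. c' v * f v)" for f :: "_ \<Rightarrow> real"
  proof -
    have "(\<Sum>v\<in>A \<union> B. (if v \<in> A then c v else 0) * f v) = (\<Sum>v\<in>A. c v * f v)"
      using A(1) B(1) by (intro sum.mono_neutral_cong_right) auto
    moreover have "(\<Sum>v\<in>A \<union> B. (if v \<in> B then c' v else 0) * f v) = (\<Sum>v\<in>B. c' v * f v)"
      using A(1) B(1) by (intro sum.mono_neutral_cong_right) auto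
    ultimately show ?thesis unfolding e_def by (simp add: distrib_right sum.distrib)
  qed
  moreover have "\<forall>v\<in>A \<union> B. e v \<ge> 0" using A(3) B(3) unfolding e_def by auto
  ultimately show ?thesis
    using A B unfolding convex_cone_of_def z w
    by (intro CollectI exI[of _ "A \<union> B"] exI[of _ e]) simp
qed

lemma convex_cone_of_sum:
  assumes "\<And>j. j \<in> J \<Longrightarrow> f j \<in> convex_cone_of \<Gamma>" and "\<And>j. j \<in> J \<Longrightarrow> 0 \<le> c j"
  shows "(\<lambda>i. \<Sum>j\<in>J. c j * fst (f j) i, \<Sum>j\<in>J. c j * snd (f j)) \<in> convex_cone_of \<Gamma>"
  using assms
proof (induction J rule: infinite_finite_induct)
  case (insert j J)
  then show ?case
    using convex_cone_of_add[OF convex_cone_of_scale[of "f j" \<Gamma> "c j"] insert.IH] by simp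
qed (simp_all add: convex_cone_of_zero)

lemma convex_cone_of_map:
  assumes f: "\<And>v. v \<in> \<Gamma> \<Longrightarrow> f v \<in> convex_cone_of \<Gamma>'"
    and linear: "\<And>A c. finite A \<Longrightarrow> f (\<lambda>i. \<Sum>v\<in>A. c v * fst v i, \<Sum>v\<in>A. c v * snd v)
      = (\<lambda>i. \<Sum>v\<in>A. c v * fst (f v) i, \<Sum>v\<in>A. c v * snd (f v))"
    and z: "z \<in> convex_cone_of \<Gamma>"
  shows "f z \<in> convex_cone_of \<Gamma>'"
proof -
  obtain A c where "z = (\<lambda>i. \<Sum>v\<in>A. c v * fst v i, \<Sum>v\<in>A. c v * snd v)"
      and A: "finite A" "A \<subseteq> \<Gamma>" "\<forall>v\<in>A. c v \<ge> 0"
    using z unfolding convex_cone_of_def by blast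
  moreover have "f v \<in> convex_cone_of \<Gamma>'" if "v \<in> A" for v using f that A(2) by blast
  ultimately show ?thesis using linear[OF A(1)] convex_cone_of_sum[of A f \<Gamma>' c] A(3) by simp
qed

lemma semigroup_multiple:
  fixes \<Gamma> :: "((nat \<Rightarrow> real) \<times> real) set"
  assumes add: "\<And>v w. v \<in> \<Gamma> \<Longrightarrow> w \<in> \<Gamma> \<Longrightarrow> (\<lambda>i. fst v i + fst w i, snd v + snd w) \<in> \<Gamma>"
    and "v \<in> \<Gamma>" and "0 < k"
  shows "(\<lambda>i. real k * fst v i, real k * snd v) \<in> \<Gamma>"
  using assms(3)
proof (induction k rule: nat_induct_non_zero)
  case 1
  then show ?case using assms(2) by simp
next
  case (Suc k)
  then show ?case using add[OF assms(2) Suc.IH] by (simp add: algebra_simps)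
qed

text \<open>
  Pair every generator \<open>v\<close> on the positive side of the hyperplane with every generator \<open>w\<close> on the
  negative side. As the functional takes integral values, the combination \<open>- l w * v + l v * w\<close> lies
  in the semigroup, and it lies on the hyperplane. A combination of generators that lies on the
  hyperplane balances both sides, and can therefore be redistributed over these pairs.
\<close>

lemma convex_cone_of_hyperplane:
  fixes \<Gamma> :: "((nat \<Rightarrow> real) \<times> real) set" and a b :: real
  defines "l \<equiv> \<lambda>z. b * fst z 0 - a * snd z"
  assumes add: "\<And>v w. v \<in> \<Gamma> \<Longrightarrow> w \<in> \<Gamma> \<Longrightarrow> (\<lambda>i. fst v i + fst w i, snd v + snd w) \<in> \<Gamma>"
    and int: "\<And>v. v \<in> \<Gamma> \<Longrightarrow> l v \<in> \<int>"
    and z: "z \<in> convex_cone_of \<Gamma>" "l z = 0"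
  shows "z \<in> convex_cone_of {v \<in> \<Gamma>. l v = 0}"
proof -
  obtain A c where z': "z = (\<lambda>i. \<Sum>v\<in>A. c v * fst v i, \<Sum>v\<in>A. c v * snd v)"
      and A: "finite A" "A \<subseteq> \<Gamma>" "\<forall>v\<in>A. c v \<ge> 0"
    using z(1) unfolding convex_cone_of_def by blast
  define A0 Ap An where "A0 = {v \<in> A. l v = 0}" and "Ap = {v \<in> A. l v > 0}" and "An = {v \<in> A. l v < 0}"
  have fin: "finite A0" "finite Ap" "finite An" using A(1) unfolding A0_def Ap_def An_def by simp_all
  have split: "(\<Sum>v\<in>A. f v) = (\<Sum>v\<in>A0. f v) + (\<Sum>v\<in>Ap. f v) + (\<Sum>v\<in>An. f v)" for f :: "_ \<Rightarrow> real"
  proof -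
    have "A = A0 \<union> Ap \<union> An" unfolding A0_def Ap_def An_def by auto
    moreover have "A0 \<inter> Ap = {}" "(A0 \<union> Ap) \<inter> An = {}" unfolding A0_def Ap_def An_def by auto
    ultimately show ?thesis using fin by (simp add: sum.union_disjoint)
  qed
  (* P is the weight on the positive side, which equals the weight on the negative side. *)
  define P where "P = (\<Sum>v\<in>Ap. c v * l v)"
  have "(\<Sum>v\<in>A. c v * l v) = l z"
    unfolding l_def z' by (simp add: right_diff_distrib sum_subtractf sum_distrib_left mult.left_commute)
  then have "(\<Sum>v\<in>A0. c v * l v) + P + (\<Sum>v\<in>An. c v * l v) = 0"
    unfolding split P_def using z(2) by simp
  moreover have "(\<Sum>v\<in>A0. c v * l v) = 0" unfolding A0_def by simp
  ultimately have N: "(\<Sum>v\<in>An. c v * (- l v)) = P" by (simp add: sum_negf)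
  have nonneg: "0 \<le> c v * l v" if "v \<in> Ap" for v using that A(3) unfolding Ap_def by simp
  then have "0 \<le> P" unfolding P_def by (intro sum_nonneg)
  let ?H = "{v \<in> \<Gamma>. l v = 0}"
  have gen0: "v \<in> convex_cone_of ?H" if "v \<in> A0" for v
    using that A(2) unfolding A0_def by (intro convex_cone_of_generator) auto
  have c0: "0 \<le> c v" if "v \<in> A0" for v using that A(3) unfolding A0_def by simp
  note zero_part = convex_cone_of_sum[of A0 "\<lambda>v. v" ?H c, OF gen0 c0]
  show ?thesis
  proof (cases "P = 0")
    case True
    have "c v = 0" if "v \<in> Ap" for v
    proof -
      have "c v * l v = 0"
        using sum_nonneg_eq_0_iff[OF fin(2), of "\<lambda>v. c v * l v"] nonneg True that unfolding P_def by simp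
      then show ?thesis using that unfolding Ap_def by simp
    qed
    moreover have "c v = 0" if "v \<in> An" for v
    proof -
      have "\<forall>v\<in>An. 0 \<le> c v * (- l v)" using A(3) unfolding An_def by (auto intro!: mult_nonneg_nonpos)
      then have "c v * (- l v) = 0"
        using sum_nonneg_eq_0_iff[OF fin(3), of "\<lambda>v. c v * (- l v)"] N True that by simp
      then show ?thesis using that unfolding An_def by simp
    qed
    ultimately have "z = (\<lambda>i. \<Sum>v\<in>A0. c v * fst v i, \<Sum>v\<in>A0. c v * snd v)"
      unfolding z' split by simp
    then show ?thesis using zero_part by simp
  next
    case False
    then have "0 < P" using \<open>0 \<le> P\<close> by simp
    define pair :: "((nat \<Rightarrow> real) \<times> real) \<times> ((nat \<Rightarrow> real) \<times> real) \<Rightarrow> (nat \<Rightarrow> real) \<times> real"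
      where "pair = (\<lambda>(v, w). (\<lambda>i. - l w * fst v i + l v * fst w i, - l w * snd v + l v * snd w))"
    have pair: "pair (v, w) \<in> convex_cone_of ?H" if "v \<in> Ap" "w \<in> An" for v w
    proof -
      have \<Gamma>: "v \<in> \<Gamma>" "w \<in> \<Gamma>" and pos: "0 < l v" "0 < - l w"
        using that A(2) unfolding Ap_def An_def by auto
      define k m where "k = nat \<lfloor>l v\<rfloor>" and "m = nat \<lfloor>- l w\<rfloor>"
      have km: "l v = real k" "- l w = real m"
        using pos int[OF \<Gamma>(1)] int[OF \<Gamma>(2)] unfolding k_def m_def by (auto elim!: Ints_cases)
      then have "0 < k" "0 < m" using pos by simp_all
      then have "pair (v, w) \<in> \<Gamma>"
        using add[OF semigroup_multiple[OF add \<Gamma>(1), of m] semigroup_multiple[OF add \<Gamma>(2), of k]]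
        unfolding pair_def prod.case km by simp
      moreover have "l (pair (v, w)) = - l w * l v + l v * l w"
        unfolding pair_def prod.case l_def fst_conv snd_conv by (simp only: algebra_simps)
      ultimately show ?thesis by (intro convex_cone_of_generator) simp
    qed
    have c: "0 \<le> c v * c w / P" if "v \<in> Ap" "w \<in> An" for v w
      using that A(3) \<open>0 < P\<close> unfolding Ap_def An_def by simp
    (* Give the pair (v, w) the weight c v * c w / P: summing over w returns the weight c v to v,
       because the negative side has total weight P, and symmetrically for w. *)
    have eq: "(\<Sum>(v, w)\<in>Ap \<times> An. c v * c w / P * (- l w * e v + l v * e w))
        = (\<Sum>v\<in>Ap. c v * e v) + (\<Sum>w\<in>An. c w * e w)" for e :: "_ \<Rightarrow> real"
    proof -
      have "(\<Sum>(v, w)\<in>Ap \<times> An. c v * c w / P * (- l w * e v + l v * e w))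
          = (\<Sum>v\<in>Ap. \<Sum>w\<in>An. (c v * e v) * (c w * (- l w)) / P + (c v * l v) * (c w * e w) / P)"
        unfolding sum.cartesian_product[symmetric]
        by (intro sum.cong refl) (simp add: divide_simps, simp add: algebra_simps)
      also have "\<dots> = (\<Sum>v\<in>Ap. c v * e v) * (\<Sum>w\<in>An. c w * (- l w)) / P
          + (\<Sum>v\<in>Ap. c v * l v) * (\<Sum>w\<in>An. c w * e w) / P"
        unfolding sum.distrib sum_product sum_divide_distrib ..
      also have "\<dots> = (\<Sum>v\<in>Ap. c v * e v) + (\<Sum>w\<in>An. c w * e w)"
        unfolding N P_def[symmetric] using \<open>0 < P\<close> by simp
      finally show ?thesis .
    qed
    have "(\<lambda>i. \<Sum>p\<in>Ap \<times> An. (case p of (v, w) \<Rightarrow> c v * c w / P) * fst (pair p) i,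
        \<Sum>p\<in>Ap \<times> An. (case p of (v, w) \<Rightarrow> c v * c w / P) * snd (pair p)) \<in> convex_cone_of ?H"
      by (rule convex_cone_of_sum) (use pair c in auto)
    moreover have "(\<Sum>p\<in>Ap \<times> An. (case p of (v, w) \<Rightarrow> c v * c w / P) * fst (pair p) i)
        = (\<Sum>v\<in>Ap. c v * fst v i) + (\<Sum>w\<in>An. c w * fst w i)" for i
      unfolding eq[symmetric] pair_def by (intro sum.cong refl) (simp split: prod.splits)
    moreover have "(\<Sum>p\<in>Ap \<times> An. (case p of (v, w) \<Rightarrow> c v * c w / P) * snd (pair p))
        = (\<Sum>v\<in>Ap. c v * snd v) + (\<Sum>w\<in>An. c w * snd w)"
      unfolding eq[symmetric] pair_def by (intro sum.cong refl) (simp split: prod.splits)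
    ultimately have "(\<lambda>i. (\<Sum>v\<in>Ap. c v * fst v i) + (\<Sum>w\<in>An. c w * fst w i),
        (\<Sum>v\<in>Ap. c v * snd v) + (\<Sum>w\<in>An. c w * snd w)) \<in> convex_cone_of ?H" by simp
    from convex_cone_of_add[OF zero_part this] show ?thesis
      unfolding z' split by (simp add: add.assoc)
  qed
qed

section \<open>Slices of the closure of a cone\<close>

text \<open>
  Euclidean space is a subspace of the space of all functions, so closures can be computed there.
\<close>

lemma closure_of_Euclidean_prod:
  "prod_topology (Euclidean_space d) euclideanreal closure_of C
    = {z. \<forall>i\<ge>d. fst z i = 0} \<inter> closure ({z. \<forall>i\<ge>d. fst z i = 0} \<inter> C)"
proof -
  have "Euclidean_space d = top_of_set {x. \<forall>i\<ge>d. x i = 0}"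
    by (simp add: Euclidean_space_def euclidean_product_topology)
  then have "prod_topology (Euclidean_space d) euclideanreal = top_of_set ({x. \<forall>i\<ge>d. x i = 0} \<times> UNIV)"
    using prod_topology_subtopology_eu[of "{x. \<forall>i\<ge>d. x i = 0}" "UNIV :: real set"] by simp
  moreover have "{x. \<forall>i\<ge>d. x i = 0} \<times> UNIV = {z :: (nat \<Rightarrow> real) \<times> real. \<forall>i\<ge>d. fst z i = 0}" by auto
  ultimately show ?thesis by (simp add: closure_of_subtopology)
qed

text \<open>The Newton-Okounkov body of an arbitrary semigroup.\<close>

definition height_one_slice :: "nat \<Rightarrow> ((nat \<Rightarrow> real) \<times> real) set \<Rightarrow> (nat \<Rightarrow> real) set" where
  "height_one_slice d \<Gamma> =
    {x. (x, 1) \<in> prod_topology (Euclidean_space d) euclideanreal closure_of convex_cone_of \<Gamma>}"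

lemma mem_height_one_slice_iff:
  assumes "\<And>v i. v \<in> \<Gamma> \<Longrightarrow> d \<le> i \<Longrightarrow> fst v i = 0"
  shows "x \<in> height_one_slice d \<Gamma> \<longleftrightarrow> (\<forall>i\<ge>d. x i = 0) \<and> (x, 1) \<in> closure (convex_cone_of \<Gamma>)"
proof -
  have "fst z i = 0" if z: "z \<in> convex_cone_of \<Gamma>" and i: "d \<le> i" for z i
  proof -
    obtain A c where "z = (\<lambda>i. \<Sum>v\<in>A. c v * fst v i, \<Sum>v\<in>A. c v * snd v)" "A \<subseteq> \<Gamma>"
      using z unfolding convex_cone_of_def by blast
    then show ?thesis using assms i by (auto intro!: sum.neutral)
  qed
  then have "{z. \<forall>i\<ge>d. fst z i = 0} \<inter> convex_cone_of \<Gamma> = convex_cone_of \<Gamma>" by auto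
  then show ?thesis unfolding height_one_slice_def closure_of_Euclidean_prod by simp
qed

lemma closure_map:
  assumes "continuous_on UNIV f" and "\<And>z. z \<in> C \<Longrightarrow> f z \<in> C'" and "z \<in> closure C"
  shows "f z \<in> closure C'"
proof -
  have "f ` closure C \<subseteq> closure C'"
    using assms(2) closure_subset
    by (intro image_closure_subset) (auto intro: continuous_on_subset[OF assms(1)])
  then show ?thesis using assms(3) by blast
qed

lemma continuous_on_fst_coordinate [continuous_intros]:
  "continuous_on S (\<lambda>z :: (nat \<Rightarrow> real) \<times> real. fst z i)"
  by (rule continuous_on_product_then_coordinatewise) (intro continuous_intros)

text \<open>
  If the cone has points on both sides of the hyperplane, then it is retracted onto its section by
  adding just enough of a point on the opposite side; this retraction is continuous, fixes the
  hyperplane, and so carries the closure of the cone into the closure of the section.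
\<close>

lemma closure_convex_cone_of_hyperplane:
  fixes \<Gamma> :: "((nat \<Rightarrow> real) \<times> real) set" and a b :: real
  defines "l \<equiv> \<lambda>z. b * fst z 0 - a * snd z"
  assumes p: "p \<in> convex_cone_of \<Gamma>" "0 < l p" and q: "q \<in> convex_cone_of \<Gamma>" "l q < 0"
    and z: "z \<in> closure (convex_cone_of \<Gamma>)" "l z = 0"
  shows "z \<in> closure {z \<in> convex_cone_of \<Gamma>. l z = 0}"
proof -
  define r s where "r = (\<lambda>z. max 0 (- l z) / l p)" and "s = (\<lambda>z. max 0 (l z) / (- l q))"
  define h where "h = (\<lambda>z. (\<lambda>i. fst z i + (r z * fst p i + s z * fst q i),
    snd z + (r z * snd p + s z * snd q)))"
  have "continuous_on UNIV l" unfolding l_def by (intro continuous_intros)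
  then have rs: "continuous_on UNIV r" "continuous_on UNIV s"
    unfolding r_def s_def using p(2) q(2) by (intro continuous_intros; auto)+
  have "continuous_on UNIV h"
    unfolding h_def
    by (intro continuous_on_Pair continuous_on_coordinatewise_then_product continuous_intros rs)
  moreover have "h z \<in> {z \<in> convex_cone_of \<Gamma>. l z = 0}" if "z \<in> convex_cone_of \<Gamma>" for z
  proof -
    have "0 \<le> r z" "0 \<le> s z" using p(2) q(2) unfolding r_def s_def by (intro divide_nonneg_pos; simp)+
    then have "h z \<in> convex_cone_of \<Gamma>"
      unfolding h_def using convex_cone_of_add[OF that convex_cone_of_add[OF
            convex_cone_of_scale[OF p(1), of "r z"] convex_cone_of_scale[OF q(1), of "s z"]]] by simp
    moreover have "l (h z) = l z + r z * l p + s z * l q"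
      unfolding h_def l_def by (simp add: algebra_simps)
    then have "l (h z) = 0" using p(2) q(2) unfolding r_def s_def by (simp add: max_def)
    ultimately show ?thesis by simp
  qed
  ultimately have "h z \<in> closure {z \<in> convex_cone_of \<Gamma>. l z = 0}"
    using z(1) by (rule closure_map)
  moreover have "h z = z" unfolding h_def r_def s_def using z(2) by simp
  ultimately show ?thesis by simp
qed

text \<open>
  This is how a slice through the interior of a body yields points of the body on both sides of it.
\<close>

lemma interior_of_Euclidean_perturb:
  assumes x: "x \<in> Euclidean_space d interior_of S" and "0 < d"
  obtains e where "0 < e" and "x(0 := x 0 + e) \<in> S" and "x(0 := x 0 - e) \<in> S"
proof -
  have E: "Euclidean_space d = top_of_set {x. \<forall>i\<ge>d. x i = 0}"
    by (simp add: Euclidean_space_def euclidean_product_topology)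
  obtain T where T: "openin (Euclidean_space d) T" "x \<in> T" "T \<subseteq> S"
    using x unfolding interior_of_def by blast
  then obtain U where U: "open U" "T = {x. \<forall>i\<ge>d. x i = 0} \<inter> U" unfolding E openin_open by blast
  define f where "f = (\<lambda>e. x(0 := x 0 + e))"
  have "continuous_on UNIV f"
    unfolding f_def
  proof (rule continuous_on_coordinatewise_then_product)
    show "continuous_on UNIV (\<lambda>e. (x(0 := x 0 + e)) i)" for i
      by (cases "i = 0") (auto intro!: continuous_intros)
  qed
  then have "open (f -` U)" by (rule open_vimage[OF U(1)])
  moreover have "0 \<in> f -` U" using T(2) U(2) unfolding f_def by simp
  ultimately obtain e where e: "0 < e" "ball 0 e \<subseteq> f -` U" unfolding open_contains_ball by blast
  have mem: "f r \<in> S" if "\<bar>r\<bar> < e" for r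
  proof -
    have "r \<in> ball 0 e" using that by (simp add: dist_real_def)
    then have "f r \<in> U" using e(2) by blast
    moreover have "\<forall>i\<ge>d. f r i = 0" using T(2) U(2) \<open>0 < d\<close> unfolding f_def by simp
    ultimately show ?thesis using U(2) T(3) by blast
  qed
  show thesis
    using that[of "e / 2"] mem[of "e / 2"] mem[of "- (e / 2)"] e(1) unfolding f_def by simp
qed

text \<open>
  The section of the cone by the hyperplane \<open>b x\<^sub>0 = a k\<close> is the cone over the section of the semigroup,
  which the linear map \<open>(y, k) \<mapsto> ((a k, y), b k)\<close> identifies with \<open>\<Gamma>'\<close>. Height one for \<open>\<Gamma>'\<close> becomes
  height \<open>b\<close> for \<open>\<Gamma>\<close>, whence the factor \<open>1 / b\<close>.
\<close>

theorem height_one_slice_hyperplane: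
  fixes \<Gamma> \<Gamma>' :: "((nat \<Rightarrow> real) \<times> real) set" and a b :: real
  assumes add: "\<And>v w. v \<in> \<Gamma> \<Longrightarrow> w \<in> \<Gamma> \<Longrightarrow> (\<lambda>i. fst v i + fst w i, snd v + snd w) \<in> \<Gamma>"
    and int: "\<And>v. v \<in> \<Gamma> \<Longrightarrow> b * fst v 0 - a * snd v \<in> \<int>"
    and supp: "\<And>v i. v \<in> \<Gamma> \<Longrightarrow> Suc d \<le> i \<Longrightarrow> fst v i = 0"
    and \<Gamma>': "\<And>y k. (y, k) \<in> \<Gamma>' \<longleftrightarrow> (\<lambda>i. case i of 0 \<Rightarrow> a * k | Suc j \<Rightarrow> y j, b * k) \<in> \<Gamma>"
    and b: "0 < b"
    and meets: "{x. x 0 = a / b} \<inter> Euclidean_space (Suc d) interior_of height_one_slice (Suc d) \<Gamma> \<noteq> {}"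
  shows "(\<lambda>x i. x (Suc i)) ` {x \<in> height_one_slice (Suc d) \<Gamma>. x 0 = a / b}
    = (\<lambda>y i. (1 / b) * y i) ` height_one_slice d \<Gamma>'"
proof -
  define l where "l = (\<lambda>z :: (nat \<Rightarrow> real) \<times> real. b * fst z 0 - a * snd z)"
  define \<phi> where "\<phi> = (\<lambda>z :: (nat \<Rightarrow> real) \<times> real.
    (\<lambda>i. case i of 0 \<Rightarrow> a * snd z | Suc j \<Rightarrow> fst z j, b * snd z))"
  (* psi inverts phi on the hyperplane, and sigma c is scaling by c. *)
  define \<psi> where "\<psi> = (\<lambda>z :: (nat \<Rightarrow> real) \<times> real. (\<lambda>i. fst z (Suc i), snd z / b))"
  define \<sigma> where "\<sigma> = (\<lambda>c (z :: (nat \<Rightarrow> real) \<times> real). (\<lambda>i. c * fst z i, c * snd z))"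
  have supp': "fst v i = 0" if "v \<in> \<Gamma>'" "d \<le> i" for v i
    using supp[of "\<phi> v" "Suc i"] \<Gamma>'[of "fst v" "snd v"] that unfolding \<phi>_def by simp
  have slice: "x \<in> height_one_slice (Suc d) \<Gamma>
      \<longleftrightarrow> (\<forall>i\<ge>Suc d. x i = 0) \<and> (x, 1) \<in> closure (convex_cone_of \<Gamma>)" for x
    using supp by (rule mem_height_one_slice_iff)
  have slice': "x \<in> height_one_slice d \<Gamma>'
      \<longleftrightarrow> (\<forall>i\<ge>d. x i = 0) \<and> (x, 1) \<in> closure (convex_cone_of \<Gamma>')" for x
    using supp' by (rule mem_height_one_slice_iff)
  have cont: "continuous_on UNIV \<phi>" "continuous_on UNIV \<psi>" "continuous_on UNIV (\<sigma> c)" for c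
  proof -
    have "continuous_on UNIV (\<lambda>z :: (nat \<Rightarrow> real) \<times> real. case i of 0 \<Rightarrow> a * snd z | Suc j \<Rightarrow> fst z j)" for i
      by (cases i) (auto intro!: continuous_intros)
    then show "continuous_on UNIV \<phi>"
      unfolding \<phi>_def
      by (intro continuous_on_Pair continuous_on_coordinatewise_then_product continuous_intros)
    show "continuous_on UNIV \<psi>" "continuous_on UNIV (\<sigma> c)"
      unfolding \<psi>_def \<sigma>_def using b
      by (intro continuous_on_Pair continuous_on_coordinatewise_then_product continuous_intros; simp)+
  qed
  have \<phi>_cone: "\<phi> z \<in> convex_cone_of \<Gamma>" if "z \<in> convex_cone_of \<Gamma>'" for z
  proof (rule convex_cone_of_map[OF _ _ that])
    show "\<phi> v \<in> convex_cone_of \<Gamma>" if "v \<in> \<Gamma>'" for v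
      using that \<Gamma>'[of "fst v" "snd v"] unfolding \<phi>_def by (intro convex_cone_of_generator) simp
    show "\<phi> (\<lambda>i. \<Sum>v\<in>A. c v * fst v i, \<Sum>v\<in>A. c v * snd v)
      = (\<lambda>i. \<Sum>v\<in>A. c v * fst (\<phi> v) i, \<Sum>v\<in>A. c v * snd (\<phi> v))" for A c
      unfolding \<phi>_def by (auto simp: fun_eq_iff sum_distrib_left mult.left_commute split: nat.split)
  qed
  have \<psi>_cone: "\<psi> z \<in> convex_cone_of \<Gamma>'" if z: "z \<in> {z \<in> convex_cone_of \<Gamma>. l z = 0}" for z
  proof -
    have "z \<in> convex_cone_of {v \<in> \<Gamma>. l v = 0}"
      using convex_cone_of_hyperplane[of \<Gamma> b a z, OF add int] z unfolding l_def by simp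
    then show ?thesis
    proof (rule convex_cone_of_map[rotated 2])
      fix v assume v: "v \<in> {v \<in> \<Gamma>. l v = 0}"
      then have "fst v 0 = a * (snd v / b)" using b unfolding l_def by (simp add: field_simps)
      then have eq: "(\<lambda>i. case i of 0 \<Rightarrow> a * (snd v / b) | Suc j \<Rightarrow> fst v (Suc j), b * (snd v / b)) = v"
        using b by (auto simp: prod_eq_iff fun_eq_iff split: nat.split)
      have "\<psi> v \<in> \<Gamma>'" unfolding \<psi>_def \<Gamma>' eq using v by simp
      then show "\<psi> v \<in> convex_cone_of \<Gamma>'" by (rule convex_cone_of_generator)
    next
      show "\<psi> (\<lambda>i. \<Sum>v\<in>A. c v * fst v i, \<Sum>v\<in>A. c v * snd v)
        = (\<lambda>i. \<Sum>v\<in>A. c v * fst (\<psi> v) i, \<Sum>v\<in>A. c v * snd (\<psi> v))" for A c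
        unfolding \<psi>_def by (simp add: sum_divide_distrib)
    qed
  qed
  have \<sigma>_cone: "\<sigma> c z \<in> closure (convex_cone_of \<Delta>)"
    if "z \<in> closure (convex_cone_of \<Delta>)" "0 \<le> c" for c z \<Delta>
    by (rule closure_map[OF cont(3) _ that(1)]) (use convex_cone_of_scale that(2) in \<open>auto simp: \<sigma>_def\<close>)
  (* The interior point yields points of the closed cone on both sides of the hyperplane; both sides
     are open, so the cone itself has points there. *)
  obtain p q where p: "p \<in> convex_cone_of \<Gamma>" "0 < l p" and q: "q \<in> convex_cone_of \<Gamma>" "l q < 0"
  proof -
    obtain x where x: "x 0 = a / b" "x \<in> Euclidean_space (Suc d) interior_of height_one_slice (Suc d) \<Gamma>"
      using meets by blast
    obtain e where e: "0 < e" "x(0 := x 0 + e) \<in> height_one_slice (Suc d) \<Gamma>"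
        "x(0 := x 0 - e) \<in> height_one_slice (Suc d) \<Gamma>"
      using interior_of_Euclidean_perturb[OF x(2)] by auto
    have cl: "continuous_on UNIV l" unfolding l_def by (intro continuous_intros)
    have "open {z. 0 < l z}" "open {z. l z < 0}"
      using cl by (auto intro!: open_Collect_less continuous_intros)
    moreover have "0 < l (x(0 := x 0 + e), 1)" "l (x(0 := x 0 - e), 1) < 0"
      using b e(1) unfolding l_def by (simp_all add: x(1) field_simps)
    ultimately have "{z. 0 < l z} \<inter> convex_cone_of \<Gamma> \<noteq> {}" "{z. l z < 0} \<inter> convex_cone_of \<Gamma> \<noteq> {}"
      using e(2,3) open_Int_closure_eq_empty[of _ "convex_cone_of \<Gamma>"] unfolding slice by auto
    then show thesis using that by blast
  qed
  show ?thesis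
  proof (intro equalityI subsetI)
    fix y assume "y \<in> (\<lambda>x i. x (Suc i)) ` {x \<in> height_one_slice (Suc d) \<Gamma>. x 0 = a / b}"
    then obtain x where x: "x \<in> height_one_slice (Suc d) \<Gamma>" "x 0 = a / b" "y = (\<lambda>i. x (Suc i))" by blast
    have "l (x, 1) = 0" using x(2) b unfolding l_def by simp
    then have "(x, 1) \<in> closure {z \<in> convex_cone_of \<Gamma>. l z = 0}"
      using closure_convex_cone_of_hyperplane[of p \<Gamma> b a q "(x, 1)"] p q x(1) unfolding l_def slice by simp
    then have "\<psi> (x, 1) \<in> closure (convex_cone_of \<Gamma>')"
      using closure_map[OF cont(2) \<psi>_cone] by blast
    then have "\<sigma> b (\<psi> (x, 1)) \<in> closure (convex_cone_of \<Gamma>')" using \<sigma>_cone b by simp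
    moreover have "\<sigma> b (\<psi> (x, 1)) = (\<lambda>i. b * y i, 1)" unfolding \<sigma>_def \<psi>_def x(3) using b by simp
    moreover have "\<forall>i\<ge>d. b * y i = 0" using x(1,3) unfolding slice by simp
    ultimately have "(\<lambda>i. b * y i) \<in> height_one_slice d \<Gamma>'" unfolding slice' by simp
    then show "y \<in> (\<lambda>y i. (1 / b) * y i) ` height_one_slice d \<Gamma>'" using b by (intro image_eqI) auto
  next
    fix x assume "x \<in> (\<lambda>y i. (1 / b) * y i) ` height_one_slice d \<Gamma>'"
    then obtain y where y: "y \<in> height_one_slice d \<Gamma>'" "x = (\<lambda>i. (1 / b) * y i)" by blast
    then have "\<phi> (y, 1) \<in> closure (convex_cone_of \<Gamma>)"
      using closure_map[OF cont(1) \<phi>_cone] unfolding slice' by blast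
    then have "\<sigma> (1 / b) (\<phi> (y, 1)) \<in> closure (convex_cone_of \<Gamma>)" using \<sigma>_cone b by simp
    moreover define x' where "x' = (\<lambda>i. case i of 0 \<Rightarrow> a / b | Suc j \<Rightarrow> x j)"
    have "\<sigma> (1 / b) (\<phi> (y, 1)) = (x', 1)"
      unfolding \<sigma>_def \<phi>_def x'_def y(2) using b by (auto simp: fun_eq_iff split: nat.split)
    moreover have "\<forall>i\<ge>Suc d. x' i = 0"
      using y(1) unfolding slice' x'_def y(2) by (auto split: nat.split)
    ultimately have "x' \<in> height_one_slice (Suc d) \<Gamma>" unfolding slice by simp
    then show "x \<in> (\<lambda>x i. x (Suc i)) ` {x \<in> height_one_slice (Suc d) \<Gamma>. x 0 = a / b}"
      by (intro image_eqI[of _ _ x']) (auto simp: x'_def)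
  qed
qed

section \<open>Sections of Cartier divisors along the first member of the flag\<close>

context irreducible_sublocus
begin

lemma order_along_mult_unit:
  assumes "p \<in> Z" and "local_equation n V Z p g" and f: "f \<in> carrier K"
    and w: "w \<in> Units (local_ring n V Z)"
  shows "order_along n V Z (f \<otimes>\<^bsub>K\<^esub> w) = order_along n V Z f"
proof -
  note g = local_equation_along[OF assms(1,2)]
  have gK: "g \<in> carrier K" using local_functions_carrier[OF g(1)] .
  have mem: "f' \<otimes>\<^bsub>K\<^esub> v \<in> local_ideal n V Z Z [^]\<^bsub>ideals_set (local_ring n V Z)\<^esub> (k::nat)"
    if f': "f' \<in> local_ideal n V Z Z [^]\<^bsub>ideals_set (local_ring n V Z)\<^esub> k" and v: "v \<in> local_functions Z"
    for f' v k
  proof -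
    obtain u where u: "u \<in> local_functions Z" "f' = u \<otimes>\<^bsub>K\<^esub> g [^]\<^bsub>K\<^esub> k"
      using f' unfolding maximal_ideal_pow_iff[OF g(1,3)] by blast
    have "f' \<otimes>\<^bsub>K\<^esub> v = (u \<otimes>\<^bsub>K\<^esub> v) \<otimes>\<^bsub>K\<^esub> g [^]\<^bsub>K\<^esub> k"
      unfolding u(2) using gK local_functions_carrier[OF u(1)] local_functions_carrier[OF v]
      by (simp add: m_ac)
    moreover have "u \<otimes>\<^bsub>K\<^esub> v \<in> local_functions Z"
      using local_functions_mult[OF Z.irreducible_locus_axioms u(1) v] .
    ultimately show ?thesis unfolding maximal_ideal_pow_iff[OF g(1,3)] by blast
  qed
  have wZ: "w \<in> local_functions Z" "inv\<^bsub>K\<^esub> w \<in> local_functions Z" and "w \<noteq> \<zero>\<^bsub>K\<^esub>"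
    using w unfolding Units_local_ring_iff by simp_all
  then have "w \<in> Units K" using field_Units local_functions_carrier by simp
  then have "(f \<otimes>\<^bsub>K\<^esub> w) \<otimes>\<^bsub>K\<^esub> inv\<^bsub>K\<^esub> w = f" using f by (simp add: m_assoc Units_closed)
  then have "f \<otimes>\<^bsub>K\<^esub> w \<in> local_ideal n V Z Z [^]\<^bsub>ideals_set (local_ring n V Z)\<^esub> (k::nat)
      \<longleftrightarrow> f \<in> local_ideal n V Z Z [^]\<^bsub>ideals_set (local_ring n V Z)\<^esub> k" for k
    using mem[of f k w] mem[of "f \<otimes>\<^bsub>K\<^esub> w" k "inv\<^bsub>K\<^esub> w"] wZ by auto
  then show ?thesis unfolding order_along_def by simp
qed

text \<open>
  The domains of any two local equations meet on the irreducible \<open>Z\<close>, and at a common point both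
  are comparable with the local equation there.
\<close>

lemma cartier_divisor_quotient_unit:
  assumes D: "cartier_divisor n V D" and Z: "projective_variety n Z" and p: "p \<in> Z" and q: "q \<in> Z"
  shows "D q \<otimes>\<^bsub>K\<^esub> inv\<^bsub>K\<^esub> (D p) \<in> Units (local_ring n V Z)"
proof -
  have loc: "D r \<in> Units K" "\<exists>U. zariski_open n U \<and> r \<in> U \<and>
        (\<forall>q\<in>U \<inter> V. D q \<otimes>\<^bsub>K\<^esub> inv\<^bsub>K\<^esub> (D r) \<in> Units (local_ring n V {q}))" if "r \<in> Z" for r
    using D that sublocus unfolding cartier_divisor_def field_Units by auto
  obtain U where U: "zariski_open n U" "p \<in> U"
    "\<And>r. r \<in> U \<inter> V \<Longrightarrow> D r \<otimes>\<^bsub>K\<^esub> inv\<^bsub>K\<^esub> (D p) \<in> Units (local_ring n V {r})" using loc(2)[OF p] by blast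
  obtain U' where U': "zariski_open n U'" "q \<in> U'"
    "\<And>r. r \<in> U' \<inter> V \<Longrightarrow> D r \<otimes>\<^bsub>K\<^esub> inv\<^bsub>K\<^esub> (D q) \<in> Units (local_ring n V {r})" using loc(2)[OF q] by blast
  have "\<not> Z \<subseteq> (proj_space n - U) \<union> (proj_space n - U')"
  proof
    assume "Z \<subseteq> (proj_space n - U) \<union> (proj_space n - U')"
    then have "Z \<subseteq> proj_space n - U \<or> Z \<subseteq> proj_space n - U'"
      using Z U(1) U'(1) unfolding projective_variety_def zariski_open_def by simp
    then show False using p q U(2) U'(2) by blast
  qed
  then obtain r where r: "r \<in> Z" "r \<in> U" "r \<in> U'" using Z.locus_subset by blast
  define \<alpha> \<beta> where "\<alpha> = D r \<otimes>\<^bsub>K\<^esub> inv\<^bsub>K\<^esub> (D p)" and "\<beta> = D r \<otimes>\<^bsub>K\<^esub> inv\<^bsub>K\<^esub> (D q)"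
  have "\<alpha> \<in> Units (local_ring n V {r})" "\<beta> \<in> Units (local_ring n V {r})"
    unfolding \<alpha>_def \<beta>_def using U(3) U'(3) r sublocus by auto
  then have \<alpha>: "\<alpha> \<in> Units (local_ring n V Z)" and \<beta>: "\<beta> \<in> Units (local_ring n V Z)"
    using r(1) by (auto intro: Units_local_ring_mono[of "{r}" Z])
  note c = loc(1)[OF p] loc(1)[OF q] loc(1)[OF r(1)]
  have ab: "\<alpha> \<in> Units K" "\<beta> \<in> Units K" unfolding \<alpha>_def \<beta>_def using c by simp_all
  have "inv\<^bsub>K\<^esub> \<beta> \<in> Units (local_ring n V Z)"
    using \<beta> ab(2) Units_inv_inv[OF ab(2)] Units_inv_Units[OF ab(2)]
    unfolding Units_local_ring_iff by (simp add: field_Units)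
  moreover have "monoid (local_ring n V Z)"
    using cring_local_ring[OF Z.irreducible_locus_axioms] by (simp add: cring_def ring_def)
  ultimately have "\<alpha> \<otimes>\<^bsub>K\<^esub> inv\<^bsub>K\<^esub> \<beta> \<in> Units (local_ring n V Z)"
    using monoid.Units_m_closed[of "local_ring n V Z"] \<alpha> by simp
  moreover have "\<alpha> \<otimes>\<^bsub>K\<^esub> inv\<^bsub>K\<^esub> \<beta> = D q \<otimes>\<^bsub>K\<^esub> inv\<^bsub>K\<^esub> (D p)"
  proof -
    have "\<beta> \<otimes>\<^bsub>K\<^esub> (D q \<otimes>\<^bsub>K\<^esub> inv\<^bsub>K\<^esub> (D p)) = D r \<otimes>\<^bsub>K\<^esub> (inv\<^bsub>K\<^esub> (D q) \<otimes>\<^bsub>K\<^esub> D q) \<otimes>\<^bsub>K\<^esub> inv\<^bsub>K\<^esub> (D p)"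
      unfolding \<beta>_def using c by (simp only: m_assoc Units_closed Units_inv_closed m_closed)
    also have "\<dots> = \<alpha>" unfolding \<alpha>_def using c by (simp add: Units_closed)
    finally have \<alpha>\<beta>: "\<beta> \<otimes>\<^bsub>K\<^esub> (D q \<otimes>\<^bsub>K\<^esub> inv\<^bsub>K\<^esub> (D p)) = \<alpha>" .
    have x: "D q \<otimes>\<^bsub>K\<^esub> inv\<^bsub>K\<^esub> (D p) \<in> carrier K" using c by (simp add: Units_closed)
    have "\<alpha> \<otimes>\<^bsub>K\<^esub> inv\<^bsub>K\<^esub> \<beta> = (D q \<otimes>\<^bsub>K\<^esub> inv\<^bsub>K\<^esub> (D p)) \<otimes>\<^bsub>K\<^esub> (\<beta> \<otimes>\<^bsub>K\<^esub> inv\<^bsub>K\<^esub> \<beta>)"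
      unfolding \<alpha>\<beta>[symmetric] using x Units_closed[OF ab(2)] Units_inv_closed[OF ab(2)]
      by (simp only: m_ac m_closed)
    then show ?thesis using x ab(2) by simp
  qed
  ultimately show ?thesis by simp
qed

text \<open>
  The order of a section is defined in an arbitrarily chosen trivialisation; this moves it to a given
  point of \<open>Z\<close>, which for the application is the point of the flag.
\<close>

lemma section_order_multiple:
  assumes D: "cartier_divisor n V D" and Z: "projective_variety n Z" and p: "p \<in> Z"
    and g: "local_equation n V Z p g" and s: "s \<in> carrier K"
  shows "section_order n V Z (multiple n V m D) s = order_along n V Z (s \<otimes>\<^bsub>K\<^esub> D p [^]\<^bsub>K\<^esub> m)"
proof -
  define q where "q = (SOME q. q \<in> Z)"
  have q: "q \<in> Z" unfolding q_def using p by (rule someI)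
  define w where "w = D q \<otimes>\<^bsub>K\<^esub> inv\<^bsub>K\<^esub> (D p)"
  have c: "D p \<in> Units K" "D q \<in> Units K"
    using D p q sublocus unfolding cartier_divisor_def field_Units by auto
  have wK: "w \<in> carrier K" unfolding w_def using c by (simp add: Units_closed)
  have w: "w \<in> Units (local_ring n V Z)"
    unfolding w_def using cartier_divisor_quotient_unit[OF D Z p q] .
  have "w [^]\<^bsub>local_ring n V Z\<^esub> m \<in> Units (local_ring n V Z)"
    using monoid.Units_pow_closed[OF _ w, of m] cring_local_ring[OF Z.irreducible_locus_axioms]
    by (simp add: cring_def ring_def)
  then have wm: "w [^]\<^bsub>K\<^esub> m \<in> Units (local_ring n V Z)" by simp
  have "D p \<otimes>\<^bsub>K\<^esub> w = (D p \<otimes>\<^bsub>K\<^esub> inv\<^bsub>K\<^esub> (D p)) \<otimes>\<^bsub>K\<^esub> D q"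
    unfolding w_def using c by (simp only: m_ac Units_closed Units_inv_closed m_closed)
  then have "D q = D p \<otimes>\<^bsub>K\<^esub> w" using c by (simp add: Units_closed)
  then have "D q [^]\<^bsub>K\<^esub> m = D p [^]\<^bsub>K\<^esub> m \<otimes>\<^bsub>K\<^esub> w [^]\<^bsub>K\<^esub> m"
    using nat_pow_distrib c(1) wK by (simp add: Units_closed)
  then have "s \<otimes>\<^bsub>K\<^esub> D q [^]\<^bsub>K\<^esub> m = (s \<otimes>\<^bsub>K\<^esub> D p [^]\<^bsub>K\<^esub> m) \<otimes>\<^bsub>K\<^esub> w [^]\<^bsub>K\<^esub> m"
    using c(1) wK s by (simp add: Units_closed m_assoc)
  moreover have "s \<otimes>\<^bsub>K\<^esub> D p [^]\<^bsub>K\<^esub> m \<in> carrier K" using c(1) s by (simp add: Units_closed)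
  ultimately show ?thesis
    unfolding section_order_def multiple_def q_def[symmetric]
    using order_along_mult_unit[OF p g _ wm] by simp
qed

end

text \<open>
  With a fixed local equation \<open>e\<close>, the valuation is computed by dividing by the right power of \<open>e\<close>
  and restricting. That a function of sufficiently high order along \<open>Y 1\<close> may be divided by the power
  of \<open>e\<close> without leaving the local ring at the point is \<open>local_equation_divides\<close>.
\<close>

lemma flag_valuation_Suc_divide:
  assumes flag: "irreducible_flag n (Suc d) Y"
    and e: "local_equation n (Y 0) (Y 1) (flag_point (Suc d) Y) e" "e \<noteq> \<zero>\<^bsub>function_field n (Y 0)\<^esub>"
    and f: "f \<in> carrier (local_ring n (Y 0) {flag_point (Suc d) Y})"
  shows "flag_valuation n (Suc d) Y f \<nu> \<longleftrightarrow> enat (\<nu> 0) \<le> order_along n (Y 0) (Y 1) f \<and>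
    flag_valuation n d (truncated_flag Y) (restrict_ratfun n (Y 1) (f \<otimes>\<^bsub>function_field n (Y 0)\<^esub>
      inv\<^bsub>function_field n (Y 0)\<^esub> (e [^]\<^bsub>function_field n (Y 0)\<^esub> \<nu> 0))) (\<lambda>i. \<nu> (Suc i))"
proof -
  interpret irreducible_sublocus n "Y 0" "Y 1" using flag by (rule irreducible_flag_sublocus)
  let ?p = "flag_point (Suc d) Y"
  let ?e = "e [^]\<^bsub>K\<^esub> \<nu> 0"
  have p: "?p \<in> Y 1" using flag_point_mem[OF flag, of 1] by simp
  note flag' = irreducible_flag_truncated[OF flag]
  have eK: "e \<in> carrier K" using e(1) local_functions_carrier unfolding local_equation_def by blast
  have eU: "?e \<in> Units K" using pow_nonzero[OF eK e(2)] eK by (simp add: field_Units)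
  have cancel: "(?e \<otimes>\<^bsub>K\<^esub> x) \<otimes>\<^bsub>K\<^esub> inv\<^bsub>K\<^esub> ?e = x" if "x \<in> carrier K" for x
  proof -
    have "(?e \<otimes>\<^bsub>K\<^esub> x) \<otimes>\<^bsub>K\<^esub> inv\<^bsub>K\<^esub> ?e = x \<otimes>\<^bsub>K\<^esub> (?e \<otimes>\<^bsub>K\<^esub> inv\<^bsub>K\<^esub> ?e)"
      using that eK Units_inv_closed[OF eU] by (simp only: m_ac nat_pow_closed m_closed)
    then show ?thesis using that eU by simp
  qed
  show ?thesis
  proof
    assume val: "flag_valuation n (Suc d) Y f \<nu>"
    then obtain g u where g: "local_equation n (Y 0) (Y 1) ?p g" and u: "u \<in> local_functions {?p}"
        and fg: "f = g [^]\<^bsub>K\<^esub> \<nu> 0 \<otimes>\<^bsub>K\<^esub> u"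
        and val': "flag_valuation n d (truncated_flag Y) (res u) (\<lambda>i. \<nu> (Suc i))"
      unfolding flag_valuation_Suc_iff[OF flag] by blast
    obtain w where w: "w \<in> Units (local_ring n (Y 0) {?p})" "g = e \<otimes>\<^bsub>K\<^esub> w"
      using local_equation_unique[OF p e(1) g] .
    define v where "v = w [^]\<^bsub>K\<^esub> \<nu> 0"
    have v: "v \<in> Units (local_ring n (Y 0) {?p})"
      using monoid.Units_pow_closed[OF _ w(1), of "\<nu> 0"] cring_local_ring[OF irreducible_point[OF p]]
      unfolding v_def by (simp add: cring_def ring_def)
    then have vp: "v \<in> local_functions {?p}" unfolding Units_local_ring_iff by simp
    have wK: "w \<in> carrier K"
      using w(1) local_functions_carrier unfolding Units_local_ring_iff by blast
    have c: "u \<in> carrier K" "v \<in> carrier K" using u vp local_functions_carrier by blast+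
    have "f = ?e \<otimes>\<^bsub>K\<^esub> (u \<otimes>\<^bsub>K\<^esub> v)"
      unfolding fg w(2) v_def using nat_pow_distrib eK wK c by (simp add: m_ac)
    then have "f \<otimes>\<^bsub>K\<^esub> inv\<^bsub>K\<^esub> ?e = u \<otimes>\<^bsub>K\<^esub> v" using cancel c by simp
    then have res: "res (f \<otimes>\<^bsub>K\<^esub> inv\<^bsub>K\<^esub> ?e) = res u \<otimes>\<^bsub>Z.K\<^esub> res v"
      using restrict_mult[OF local_functions_point_mono[OF p u] local_functions_point_mono[OF p vp]] by simp
    have "res v \<in> Units (local_ring n (truncated_flag Y 0) {flag_point d (truncated_flag Y)})"
      using restrict_Units[OF _ v] p unfolding flag_point_truncated by (simp add: truncated_flag_def)
    from flag_valuation_mult_unit[OF flag' val' this]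
    have "flag_valuation n d (truncated_flag Y) (res (f \<otimes>\<^bsub>K\<^esub> inv\<^bsub>K\<^esub> ?e)) (\<lambda>i. \<nu> (Suc i))"
      unfolding res by (simp add: truncated_flag_def)
    moreover have "enat (\<nu> 0) \<le> order_along n (Y 0) (Y 1) f" using val by simp
    ultimately show "enat (\<nu> 0) \<le> order_along n (Y 0) (Y 1) f \<and>
        flag_valuation n d (truncated_flag Y) (res (f \<otimes>\<^bsub>K\<^esub> inv\<^bsub>K\<^esub> ?e)) (\<lambda>i. \<nu> (Suc i))" by simp
  next
    assume rhs: "enat (\<nu> 0) \<le> order_along n (Y 0) (Y 1) f \<and>
        flag_valuation n d (truncated_flag Y) (res (f \<otimes>\<^bsub>K\<^esub> inv\<^bsub>K\<^esub> ?e)) (\<lambda>i. \<nu> (Suc i))"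
    obtain u where u: "u \<in> local_functions (Y 1)" "f = u \<otimes>\<^bsub>K\<^esub> ?e"
      using order_along_geE[OF p e(1) local_functions_point_mono[OF p f]] rhs by blast
    have up: "u \<in> local_functions {?p}" using local_equation_divides[OF p e f u] .
    have uK: "u \<in> carrier K" using local_functions_carrier[OF up] .
    have fu: "f = ?e \<otimes>\<^bsub>K\<^esub> u" using u(2) uK eK by (simp add: m_comm)
    then have "f \<otimes>\<^bsub>K\<^esub> inv\<^bsub>K\<^esub> ?e = u" using cancel[OF uK] by simp
    then show "flag_valuation n (Suc d) Y f \<nu>"
      unfolding flag_valuation_Suc_iff[OF flag] using e up fu rhs
      by (intro exI[of _ e] exI[of _ u]) simp
  qed
qed

section \<open>Valuation semigroups\<close>

lemma newton_okounkov_body_eq_slice: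
  "newton_okounkov_body n d Y D S = height_one_slice d (valuation_semigroup n d Y D S)"
  unfolding newton_okounkov_body_def height_one_slice_def ..

lemma mem_valuation_semigroup_iff:
  "v \<in> valuation_semigroup n d Y D S \<longleftrightarrow> (\<exists>\<nu> k s. v = (\<lambda>i. real (\<nu> i), real k) \<and> s \<in> S k \<and>
     s \<noteq> \<zero>\<^bsub>function_field n (Y 0)\<^esub> \<and> flag_valuation n d Y (s \<otimes>\<^bsub>function_field n (Y 0)\<^esub>
       D (flag_point d Y) [^]\<^bsub>function_field n (Y 0)\<^esub> k) \<nu>)"
  unfolding valuation_semigroup_def multiple_def by blast

lemma graded_linear_series_regular:
  assumes "graded_linear_series n X D S" and "s \<in> S k" and "p \<in> X"
  shows "s \<in> carrier (function_field n X)"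
    and "s \<otimes>\<^bsub>function_field n X\<^esub> D p [^]\<^bsub>function_field n X\<^esub> k \<in> carrier (local_ring n X {p})"
proof -
  have "s \<in> global_sections n X (multiple n X k D)"
    using assms(1,2) unfolding graded_linear_series_def by blast
  then show "s \<in> carrier (function_field n X)"
    and "s \<otimes>\<^bsub>function_field n X\<^esub> D p [^]\<^bsub>function_field n X\<^esub> k \<in> carrier (local_ring n X {p})"
    using assms(3) unfolding global_sections_def multiple_def by simp_all
qed

text \<open>
  Products of sections are sections, their trivialisations at the point of the flag multiply, and the
  valuation is additive.
\<close>

lemma valuation_semigroup_add:
  assumes flag: "irreducible_flag n d Y" and S: "graded_linear_series n (Y 0) D S"
    and D: "D (flag_point d Y) \<in> carrier (function_field n (Y 0))"
    and v: "v \<in> valuation_semigroup n d Y D S" and w: "w \<in> valuation_semigroup n d Y D S"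
  shows "(\<lambda>i. fst v i + fst w i, snd v + snd w) \<in> valuation_semigroup n d Y D S"
proof -
  interpret irreducible_locus n "Y 0" using flag unfolding irreducible_flag_def by simp
  let ?p = "flag_point d Y"
  have p: "?p \<in> Y 0" using flag_point_mem[OF flag] by simp
  obtain \<nu> k s where v': "v = (\<lambda>i. real (\<nu> i), real k)" and s: "s \<in> S k" "s \<noteq> \<zero>\<^bsub>K\<^esub>"
      and fs: "flag_valuation n d Y (s \<otimes>\<^bsub>K\<^esub> D ?p [^]\<^bsub>K\<^esub> k) \<nu>"
    using v unfolding mem_valuation_semigroup_iff by blast
  obtain \<nu>' l s' where w': "w = (\<lambda>i. real (\<nu>' i), real l)" and s': "s' \<in> S l" "s' \<noteq> \<zero>\<^bsub>K\<^esub>"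
      and fs': "flag_valuation n d Y (s' \<otimes>\<^bsub>K\<^esub> D ?p [^]\<^bsub>K\<^esub> l) \<nu>'"
    using w unfolding mem_valuation_semigroup_iff by blast
  have c: "s \<in> carrier K" "s' \<in> carrier K"
    using graded_linear_series_regular(1)[OF S _ p] s(1) s'(1) by blast+
  have "D ?p [^]\<^bsub>K\<^esub> (k + l) = D ?p [^]\<^bsub>K\<^esub> k \<otimes>\<^bsub>K\<^esub> D ?p [^]\<^bsub>K\<^esub> l" using nat_pow_mult[OF D] by simp
  then have "(s \<otimes>\<^bsub>K\<^esub> D ?p [^]\<^bsub>K\<^esub> k) \<otimes>\<^bsub>K\<^esub> (s' \<otimes>\<^bsub>K\<^esub> D ?p [^]\<^bsub>K\<^esub> l) = (s \<otimes>\<^bsub>K\<^esub> s') \<otimes>\<^bsub>K\<^esub> D ?p [^]\<^bsub>K\<^esub> (k + l)"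
    using c D by (simp add: m_ac)
  then have "flag_valuation n d Y ((s \<otimes>\<^bsub>K\<^esub> s') \<otimes>\<^bsub>K\<^esub> D ?p [^]\<^bsub>K\<^esub> (k + l)) (\<lambda>i. \<nu> i + \<nu>' i)"
    using flag_valuation_mult[OF flag fs fs'] by simp
  moreover have "s \<otimes>\<^bsub>K\<^esub> s' \<in> S (k + l)" using S s(1) s'(1) unfolding graded_linear_series_def by blast
  moreover have "s \<otimes>\<^bsub>K\<^esub> s' \<noteq> \<zero>\<^bsub>K\<^esub>" using integral_iff c s(2) s'(2) by simp
  ultimately show ?thesis
    unfolding mem_valuation_semigroup_iff v' w'
    by (intro exI[of _ "\<lambda>i. \<nu> i + \<nu>' i"] exI[of _ "k + l"] exI[of _ "s \<otimes>\<^bsub>K\<^esub> s'"]) simp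
qed

lemma valuation_semigroup_support:
  "v \<in> valuation_semigroup n d Y D S \<Longrightarrow> d \<le> i \<Longrightarrow> fst v i = 0"
  unfolding mem_valuation_semigroup_iff by (auto dest: flag_valuation_support)

section \<open>Restricted series and slices of the Newton-Okounkov body\<close>

text \<open>
  The local equation of \<open>b D - a E\<close> at the point \<open>p\<close> of the flag is \<open>D p ^ b / E p ^ a\<close>, so the
  restriction of a section \<open>s\<close> of its \<open>k\<close>-th multiple is that of \<open>s * D p ^ (b k) / E p ^ (a k)\<close>.
  If the order of \<open>s\<close> is \<open>a k\<close>, the division removes exactly the first entry \<open>a k\<close> from the valuation of \<open>s\<close>; if the order
  of \<open>s\<close> exceeds \<open>a k\<close>, the restriction is zero and contributes nothing.
\<close>

lemma mem_restricted_semigroup_iff: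
  fixes a b :: nat
  assumes flag: "irreducible_flag n (Suc d) Y" and Y1: "projective_variety n (Y 1)"
    and D: "cartier_divisor n (Y 0) D" and S: "graded_linear_series n (Y 0) D S"
    and E: "divisor_of_subvariety n (Y 0) (Y 1) E"
  shows "v \<in> valuation_semigroup n d (truncated_flag Y)
      (restricted_divisor n (Suc d) Y (difference n (Y 0) (multiple n (Y 0) b D) (multiple n (Y 0) a E)))
      (restricted_series n (Suc d) Y (difference n (Y 0) (multiple n (Y 0) b D) (multiple n (Y 0) a E))
        (subtract_subvariety n (Y 0) (Y 1) a (multiple n (Y 0) b D) (veronese b S)))
    \<longleftrightarrow> (\<exists>\<nu> k s. v = (\<lambda>i. real (\<nu> (Suc i)), real k) \<and> s \<in> S (b * k) \<and> \<nu> 0 = a * k \<and>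
      flag_valuation n (Suc d) Y (s \<otimes>\<^bsub>function_field n (Y 0)\<^esub>
        D (flag_point (Suc d) Y) [^]\<^bsub>function_field n (Y 0)\<^esub> (b * k)) \<nu>)"
    (is "v \<in> valuation_semigroup n d ?Y ?D ?S \<longleftrightarrow> _")
proof -
  (* Simplification must neither rewrite Y 1 to Y (Suc 0) nor unfold the valuation. *)
  note [simp del] = One_nat_def flag_valuation.simps(2)
  interpret irreducible_sublocus n "Y 0" "Y 1" using flag by (rule irreducible_flag_sublocus)
  define p where "p = flag_point (Suc d) Y"
  have p0: "p \<in> Y 0" and p: "p \<in> Y 1"
    unfolding p_def using flag_point_mem[OF flag, of 0] flag_point_mem[OF flag, of 1] by simp_all
  have point: "flag_point d ?Y = p" unfolding p_def by (rule flag_point_truncated)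
  have Y0: "?Y 0 = Y 1" unfolding truncated_flag_def One_nat_def ..
  have e: "local_equation n (Y 0) (Y 1) p (E p)" and E0: "E p \<in> carrier K" "E p \<noteq> \<zero>\<^bsub>K\<^esub>"
    using E p0 unfolding divisor_of_subvariety_def cartier_divisor_def by auto
  have D0: "D p \<in> carrier K" "D p \<noteq> \<zero>\<^bsub>K\<^esub>"
    using D p0 unfolding cartier_divisor_def by auto
  define D' where "D' = difference n (Y 0) (multiple n (Y 0) b D) (multiple n (Y 0) a E)"
  have D'p: "D' p = D p [^]\<^bsub>K\<^esub> b \<otimes>\<^bsub>K\<^esub> inv\<^bsub>K\<^esub> (E p [^]\<^bsub>K\<^esub> a)"
    unfolding D'_def difference_def multiple_def ..
  have U: "D p [^]\<^bsub>K\<^esub> m \<in> Units K" "E p [^]\<^bsub>K\<^esub> m \<in> Units K" for m :: nat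
    using pow_nonzero D0 E0 by (simp_all add: field_Units)
  then have D'U: "D' p \<in> Units K" unfolding D'p by simp
  have D'pow: "D' p [^]\<^bsub>K\<^esub> k = D p [^]\<^bsub>K\<^esub> (b * k) \<otimes>\<^bsub>K\<^esub> inv\<^bsub>K\<^esub> (E p [^]\<^bsub>K\<^esub> (a * k))" for k
  proof -
    have "inv\<^bsub>K\<^esub> (E p [^]\<^bsub>K\<^esub> (a * k)) = inv\<^bsub>K\<^esub> (E p [^]\<^bsub>K\<^esub> a) [^]\<^bsub>K\<^esub> k"
    proof (rule comm_inv_char)
      have "E p [^]\<^bsub>K\<^esub> (a * k) \<otimes>\<^bsub>K\<^esub> inv\<^bsub>K\<^esub> (E p [^]\<^bsub>K\<^esub> a) [^]\<^bsub>K\<^esub> k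
          = (E p [^]\<^bsub>K\<^esub> a \<otimes>\<^bsub>K\<^esub> inv\<^bsub>K\<^esub> (E p [^]\<^bsub>K\<^esub> a)) [^]\<^bsub>K\<^esub> k"
        using nat_pow_distrib[of "E p [^]\<^bsub>K\<^esub> a" "inv\<^bsub>K\<^esub> (E p [^]\<^bsub>K\<^esub> a)" k]
          nat_pow_pow[OF E0(1), of a k] E0(1) Units_inv_closed[OF U(2)[of a]] by (simp del: Units_r_inv)
      then show "E p [^]\<^bsub>K\<^esub> (a * k) \<otimes>\<^bsub>K\<^esub> inv\<^bsub>K\<^esub> (E p [^]\<^bsub>K\<^esub> a) [^]\<^bsub>K\<^esub> k = \<one>\<^bsub>K\<^esub>"
        using U(2)[of a] by simp
    qed (use E0(1) U(2)[of a] in simp_all)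
    then show ?thesis
      unfolding D'p using nat_pow_distrib[of "D p [^]\<^bsub>K\<^esub> b"] nat_pow_pow[OF D0(1)] D0(1) U(2)[of a] by simp
  qed
  (* The restricted divisor is normalised at p, so it is trivial there. *)
  have "res \<one>\<^bsub>K\<^esub> = \<one>\<^bsub>Z.K\<^esub>" by (rule restrict_one)
  then have one: "?D (flag_point d ?Y) = \<one>\<^bsub>Z.K\<^esub>"
    unfolding restricted_divisor_def point D'_def[symmetric] p_def[symmetric] using D'U by simp
  (* The defining section is 1, so subtracting a multiple of Y 1 leaves the functions unchanged and only
     imposes an order of vanishing. *)
  have W: "subtract_subvariety n (Y 0) (Y 1) a (multiple n (Y 0) b D) (veronese b S) k
      = {s \<in> S (b * k). enat (a * k) \<le> order_along n (Y 0) (Y 1) (s \<otimes>\<^bsub>K\<^esub> D p [^]\<^bsub>K\<^esub> (b * k))}" for k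
  proof -
    have "section_order n (Y 0) (Y 1) (multiple n (Y 0) k (multiple n (Y 0) b D)) s
         = order_along n (Y 0) (Y 1) (s \<otimes>\<^bsub>K\<^esub> D p [^]\<^bsub>K\<^esub> (b * k))" if s: "s \<in> S (b * k)" for s
    proof -
      have "(SOME q. q \<in> Y 1) \<in> Y 0" using someI[of "\<lambda>q. q \<in> Y 1", OF p] sublocus by blast
      then have "D (SOME q. q \<in> Y 1) \<in> carrier K" using D unfolding cartier_divisor_def by blast
      then have "section_order n (Y 0) (Y 1) (multiple n (Y 0) k (multiple n (Y 0) b D)) s
          = section_order n (Y 0) (Y 1) (multiple n (Y 0) (b * k) D) s"
        unfolding section_order_def multiple_def by (simp add: nat_pow_pow)
      then show ?thesis
        using section_order_multiple[OF D Y1 p e graded_linear_series_regular(1)[OF S s p0]] by simp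
    qed
    moreover have "s \<otimes>\<^bsub>K\<^esub> inv\<^bsub>K\<^esub> (\<one>\<^bsub>K\<^esub> [^]\<^bsub>K\<^esub> (a * k)) = s" if s: "s \<in> S (b * k)" for s
      using graded_linear_series_regular(1)[OF S s p0] by simp
    ultimately have "subtract_subvariety n (Y 0) (Y 1) a (multiple n (Y 0) b D) (veronese b S) k
        = {x. \<exists>s. x = s \<and> s \<in> S (b * k) \<and>
            enat (a * k) \<le> order_along n (Y 0) (Y 1) (s \<otimes>\<^bsub>K\<^esub> D p [^]\<^bsub>K\<^esub> (b * k))}"
      unfolding subtract_subvariety_def veronese_def defining_section_def
      by (intro Collect_cong ex_cong1) (auto simp del: nat_pow_one)
    then show ?thesis by simp
  qed
  have divide: "s \<otimes>\<^bsub>K\<^esub> multiple n (Y 0) k D' p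
      = (s \<otimes>\<^bsub>K\<^esub> D p [^]\<^bsub>K\<^esub> (b * k)) \<otimes>\<^bsub>K\<^esub> inv\<^bsub>K\<^esub> (E p [^]\<^bsub>K\<^esub> (a * k))"
    if s: "s \<in> S (b * k)" for s k
    unfolding multiple_def D'pow using graded_linear_series_regular(1)[OF S s p0] U[of "a * k"] U[of "b * k"]
    by (simp add: m_assoc Units_closed)
  have series: "?S k = (\<lambda>s. res ((s \<otimes>\<^bsub>K\<^esub> D p [^]\<^bsub>K\<^esub> (b * k)) \<otimes>\<^bsub>K\<^esub> inv\<^bsub>K\<^esub> (E p [^]\<^bsub>K\<^esub> (a * k)))) `
      {s \<in> S (b * k). enat (a * k) \<le> order_along n (Y 0) (Y 1) (s \<otimes>\<^bsub>K\<^esub> D p [^]\<^bsub>K\<^esub> (b * k))}" for k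
    unfolding restricted_series_def W D'_def[symmetric] p_def[symmetric] using divide by (intro image_cong) auto
  have val: "flag_valuation n (Suc d) Y (s \<otimes>\<^bsub>K\<^esub> D p [^]\<^bsub>K\<^esub> (b * k)) \<nu> \<longleftrightarrow>
      enat (a * k) \<le> order_along n (Y 0) (Y 1) (s \<otimes>\<^bsub>K\<^esub> D p [^]\<^bsub>K\<^esub> (b * k)) \<and>
      flag_valuation n d ?Y (res ((s \<otimes>\<^bsub>K\<^esub> D p [^]\<^bsub>K\<^esub> (b * k)) \<otimes>\<^bsub>K\<^esub> inv\<^bsub>K\<^esub> (E p [^]\<^bsub>K\<^esub> (a * k))))
        (\<lambda>i. \<nu> (Suc i))"
    if "s \<in> S (b * k)" and "\<nu> 0 = a * k" for s k \<nu>
    using flag_valuation_Suc_divide[OF flag, of "E p" _ \<nu>] e E0(2) that(2)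
      graded_linear_series_regular(2)[OF S that(1) p0] unfolding p_def by simp
  show ?thesis
  proof
    assume "v \<in> valuation_semigroup n d ?Y ?D ?S"
    then obtain \<nu> k r where v: "v = (\<lambda>i. real (\<nu> i), real k)" and r: "r \<in> ?S k"
        and r\<nu>: "flag_valuation n d ?Y (r \<otimes>\<^bsub>Z.K\<^esub> \<one>\<^bsub>Z.K\<^esub> [^]\<^bsub>Z.K\<^esub> k) \<nu>"
      unfolding mem_valuation_semigroup_iff one Y0 by blast
    obtain s where s: "s \<in> S (b * k)"
        "enat (a * k) \<le> order_along n (Y 0) (Y 1) (s \<otimes>\<^bsub>K\<^esub> D p [^]\<^bsub>K\<^esub> (b * k))"
        and rs: "r = res ((s \<otimes>\<^bsub>K\<^esub> D p [^]\<^bsub>K\<^esub> (b * k)) \<otimes>\<^bsub>K\<^esub> inv\<^bsub>K\<^esub> (E p [^]\<^bsub>K\<^esub> (a * k)))"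
      using r unfolding series by blast
    have "s \<otimes>\<^bsub>K\<^esub> D p [^]\<^bsub>K\<^esub> (b * k) \<in> local_functions (Y 1)"
      using local_functions_point_mono[OF p graded_linear_series_regular(2)[OF S s(1) p0]] .
    then obtain u where u: "u \<in> local_functions (Y 1)"
        "s \<otimes>\<^bsub>K\<^esub> D p [^]\<^bsub>K\<^esub> (b * k) = u \<otimes>\<^bsub>K\<^esub> E p [^]\<^bsub>K\<^esub> (a * k)"
      using order_along_geE[OF p e _ s(2)] by blast
    have "r = res u"
      unfolding rs u(2) using local_functions_carrier[OF u(1)] U(2)[of "a * k"]
      by (simp add: m_assoc Units_closed)
    then have "r \<in> carrier Z.K" using restrict_closed[OF u(1)] by simp
    then have "flag_valuation n d ?Y r \<nu>" using r\<nu> by simp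
    then show "\<exists>\<nu> k s. v = (\<lambda>i. real (\<nu> (Suc i)), real k) \<and> s \<in> S (b * k) \<and> \<nu> 0 = a * k \<and>
        flag_valuation n (Suc d) Y (s \<otimes>\<^bsub>K\<^esub> D (flag_point (Suc d) Y) [^]\<^bsub>K\<^esub> (b * k)) \<nu>"
      using s v val[of s k "case_nat (a * k) \<nu>"] unfolding rs p_def[symmetric]
      by (intro exI[of _ "case_nat (a * k) \<nu>"] exI[of _ k] exI[of _ s]) simp
  next
    assume "\<exists>\<nu> k s. v = (\<lambda>i. real (\<nu> (Suc i)), real k) \<and> s \<in> S (b * k) \<and> \<nu> 0 = a * k \<and>
        flag_valuation n (Suc d) Y (s \<otimes>\<^bsub>K\<^esub> D (flag_point (Suc d) Y) [^]\<^bsub>K\<^esub> (b * k)) \<nu>"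
    then obtain \<nu> k s where v: "v = (\<lambda>i. real (\<nu> (Suc i)), real k)" and s: "s \<in> S (b * k)" "\<nu> 0 = a * k"
        and s\<nu>: "flag_valuation n (Suc d) Y (s \<otimes>\<^bsub>K\<^esub> D p [^]\<^bsub>K\<^esub> (b * k)) \<nu>"
      unfolding p_def by blast
    define r where "r = res ((s \<otimes>\<^bsub>K\<^esub> D p [^]\<^bsub>K\<^esub> (b * k)) \<otimes>\<^bsub>K\<^esub> inv\<^bsub>K\<^esub> (E p [^]\<^bsub>K\<^esub> (a * k)))"
    have r: "r \<in> ?S k" and r\<nu>: "flag_valuation n d ?Y r (\<lambda>i. \<nu> (Suc i))"
      using s\<nu> s(1) unfolding val[of s k \<nu>, OF s] series r_def by simp_all
    note nz = flag_valuation_nonzero[OF irreducible_flag_truncated[OF flag] r\<nu>, unfolded Y0]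
    have "r \<otimes>\<^bsub>Z.K\<^esub> \<one>\<^bsub>Z.K\<^esub> [^]\<^bsub>Z.K\<^esub> k = r" using nz(1) by simp
    then show "v \<in> valuation_semigroup n d ?Y ?D ?S"
      unfolding mem_valuation_semigroup_iff one Y0 v using r r\<nu> nz(2)
      by (intro exI[of _ "\<lambda>i. \<nu> (Suc i)"] exI[of _ k] exI[of _ r]) simp
  qed
qed

theorem theorem1:
  fixes n d a b :: nat
    and X :: "point set" and Y :: "nat \<Rightarrow> point set"
    and D E :: divisor and S :: series and t :: real
  assumes "projective_variety n X" and "dimension_of n X = enat d" and "1 \<le> d"
    and "big_divisor n X D"
    and "graded_linear_series n X D S"
    and "admissible_flag n X d Y"
    and "divisor_of_subvariety n X (Y 1) E"
    and "0 < a" and "0 < b" and "coprime a b" and "t = real a / real b"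
    and "{x. x 0 = t} \<inter> Euclidean_space d interior_of newton_okounkov_body n d Y D S \<noteq> {}"
  shows "(\<lambda>x i. x (Suc i)) ` {x \<in> newton_okounkov_body n d Y D S. x 0 = t} =
    (\<lambda>y i. (1 / real b) * y i) `
      restricted_body n d Y
        (difference n X (multiple n X b D) (multiple n X a E))
        (subtract_subvariety n X (Y 1) a (multiple n X b D) (veronese b S))"
proof -
  (* Simplification must neither rewrite Y 1 to Y (Suc 0) nor unfold the valuation. *)
  note [simp del] = One_nat_def flag_valuation.simps(2)
  obtain d' where d: "d = Suc d'" using assms(3) by (cases d) auto
  have X: "X = Y 0" and Y1: "projective_variety n (Y 1)"
    using assms(3,6) unfolding admissible_flag_def by auto
  have flag: "irreducible_flag n (Suc d') Y"
    using irreducible_flag_admissible[OF assms(6)] unfolding d .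
  have D: "cartier_divisor n (Y 0) D" using assms(4) unfolding big_divisor_def X by simp
  have S: "graded_linear_series n (Y 0) D S" using assms(5) unfolding X .
  have E: "divisor_of_subvariety n (Y 0) (Y 1) E" using assms(7) unfolding X .
  define p where "p = flag_point (Suc d') Y"
  have p: "p \<in> Y 0" unfolding p_def using flag_point_mem[OF flag] by simp
  have Dp: "D p \<in> carrier (function_field n (Y 0))"
    using D p unfolding cartier_divisor_def by blast
  define \<Gamma> where "\<Gamma> = valuation_semigroup n (Suc d') Y D S"
  define \<Gamma>' where "\<Gamma>' = valuation_semigroup n d' (truncated_flag Y)
      (restricted_divisor n (Suc d') Y (difference n (Y 0) (multiple n (Y 0) b D) (multiple n (Y 0) a E)))
      (restricted_series n (Suc d') Y (difference n (Y 0) (multiple n (Y 0) b D) (multiple n (Y 0) a E))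
        (subtract_subvariety n (Y 0) (Y 1) a (multiple n (Y 0) b D) (veronese b S)))"
  have \<Gamma>_\<Gamma>': "(y, k) \<in> \<Gamma>' \<longleftrightarrow> (\<lambda>i. case i of 0 \<Rightarrow> real a * k | Suc j \<Rightarrow> y j, real b * k) \<in> \<Gamma>" for y k
  proof
    assume "(y, k) \<in> \<Gamma>'"
    then obtain \<nu> k' s where yk: "y = (\<lambda>i. real (\<nu> (Suc i)))" "k = real k'" and s: "s \<in> S (b * k')"
        and \<nu>: "\<nu> 0 = a * k'" and val: "flag_valuation n (Suc d') Y (s \<otimes>\<^bsub>function_field n (Y 0)\<^esub>
          D p [^]\<^bsub>function_field n (Y 0)\<^esub> (b * k')) \<nu>"
      unfolding \<Gamma>'_def mem_restricted_semigroup_iff[OF flag Y1 D S E] p_def by blast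
    interpret irreducible_sublocus n "Y 0" "Y 1" using flag by (rule irreducible_flag_sublocus)
    have nz: "s \<noteq> \<zero>\<^bsub>K\<^esub>" using flag_valuation_nonzero(2)[OF flag val] Dp by auto
    have eq: "(\<lambda>i. case i of 0 \<Rightarrow> real a * k | Suc j \<Rightarrow> y j) = (\<lambda>i. real (\<nu> i))"
      unfolding yk using \<nu> by (auto simp: fun_eq_iff split: nat.split)
    show "(\<lambda>i. case i of 0 \<Rightarrow> real a * k | Suc j \<Rightarrow> y j, real b * k) \<in> \<Gamma>"
      unfolding eq unfolding yk(2) \<Gamma>_def mem_valuation_semigroup_iff p_def[symmetric] using s val nz
      by (intro exI[of _ \<nu>] exI[of _ "b * k'"] exI[of _ s]) simp
  next
    assume "(\<lambda>i. case i of 0 \<Rightarrow> real a * k | Suc j \<Rightarrow> y j, real b * k) \<in> \<Gamma>"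
    then obtain \<nu> m s where eq: "(\<lambda>i. case i of 0 \<Rightarrow> real a * k | Suc j \<Rightarrow> y j) = (\<lambda>i. real (\<nu> i))"
        "real b * k = real m" and s: "s \<in> S m"
        and val: "flag_valuation n (Suc d') Y (s \<otimes>\<^bsub>function_field n (Y 0)\<^esub>
          D p [^]\<^bsub>function_field n (Y 0)\<^esub> m) \<nu>"
      unfolding \<Gamma>_def mem_valuation_semigroup_iff p_def by blast
    have \<nu>0: "real a * k = real (\<nu> 0)" and y: "y = (\<lambda>i. real (\<nu> (Suc i)))"
      using fun_cong[OF eq(1), of 0] fun_cong[OF eq(1), of "Suc _"] by auto
    (* Coprimality makes every element of the semigroup on the hyperplane come from an integral k'. *)
    have "real (a * m) = real (b * \<nu> 0)" using eq(2) \<nu>0 by (simp add: mult.left_commute flip: eq(2) \<nu>0)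
    then have "a * m = b * \<nu> 0" by (simp only: of_nat_eq_iff)
    then have "b dvd m" using assms(10) by (metis coprime_commute coprime_dvd_mult_right_iff dvd_triv_left)
    then obtain k' where m: "m = b * k'" by blast
    then have k: "k = real k'" using eq(2) assms(9) by simp
    have "\<nu> 0 = a * k'" using \<nu>0 unfolding k by (metis of_nat_eq_iff of_nat_mult)
    then show "(y, k) \<in> \<Gamma>'"
      unfolding \<Gamma>'_def mem_restricted_semigroup_iff[OF flag Y1 D S E] p_def[symmetric] y k
      using s val unfolding m by (intro exI[of _ \<nu>] exI[of _ k'] exI[of _ s]) simp
  qed
  have "(\<lambda>x i. x (Suc i)) ` {x \<in> height_one_slice (Suc d') \<Gamma>. x 0 = real a / real b}
    = (\<lambda>y i. (1 / real b) * y i) ` height_one_slice d' \<Gamma>'"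
  proof (rule height_one_slice_hyperplane)
    show "(\<lambda>i. fst v i + fst w i, snd v + snd w) \<in> \<Gamma>" if "v \<in> \<Gamma>" "w \<in> \<Gamma>" for v w
      using valuation_semigroup_add[OF flag S] Dp that unfolding \<Gamma>_def p_def by blast
    show "real b * fst v 0 - real a * snd v \<in> \<int>" if "v \<in> \<Gamma>" for v
      using that unfolding \<Gamma>_def mem_valuation_semigroup_iff by auto
    show "fst v i = 0" if "v \<in> \<Gamma>" "Suc d' \<le> i" for v i
      using valuation_semigroup_support that unfolding \<Gamma>_def by blast
    show "{x. x 0 = real a / real b} \<inter> Euclidean_space (Suc d') interior_of height_one_slice (Suc d') \<Gamma> \<noteq> {}"
      using assms(12) unfolding newton_okounkov_body_eq_slice d assms(11) \<Gamma>_def .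
  qed (use \<Gamma>_\<Gamma>' assms(9) in auto)
  then show ?thesis
    unfolding restricted_body_def newton_okounkov_body_eq_slice d assms(11) \<Gamma>_def \<Gamma>'_def X by simp
qed

end
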